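(* Let $\mathcal{C}$ be a small category with weak pullbacks and let $\hat{\mathcal{C}}=[\mathcal{C}^{op},\mathsf{Set}]$. For every presheaf $X\in\hat{\mathcal{C}}$, the internal power-object $P_{\hat{\mathcal{C}}}X$ (with its canonical internal suplattice structure) is given by $\mathfrak{z}(P\circ X)$, where $P\colon\mathsf{Set}\to\mathsf{SupLat}$ is the covariant power-set functor.
   Context: For an arrow $f$ of $\mathcal{C}$, $\vartheta_0 f$ is its source and $\vartheta_1 f$ its target. $\mathsf{SupLat}$ is the category of complete lattices and maps preserving arbitrary suprema. The functor $P\colon\mathsf{Set}\to\mathsf{SupLat}$ sends a set to its power set ordered by inclusion and a function to the direct image map. "Given by" means isomorphic to, as an internal suplattice; the power-object is the usual topos-theoretic power-object, ordered by inclusion. An internal suplattice in $[\mathcal{C}^{op},\mathsf{Set}]$ is (described as) a functor $L\colon\mathcal{C}^{op}\to\mathsf{SupLat}$ such that each $Lf\colon La\to Lb$ ($f\colon b\to a$) has a left adjoint $\Sigma_f\colon Lb\to La$ and the Beck-Chevalley condition $Ls\circ\Sigma_r=\Sigma_q\circ Lp$ holds for every weak pullback square $rp=sq$ in $\mathcal{C}$. Morphisms are natural transformations with sup-preserving components commuting with the maps $\Sigma_f$. For $L\colon\mathcal{C}^{op}\to\mathsf{SupLat}$, $\mathfrak{z}L$ is the internal suplattice with $$\mathfrak{z}L(a)=\Big\{(u_f)_{\vartheta_1 f=a}\in\prod_{\vartheta_1 f=a}L(\vartheta_0 f)\ \Big|\ L(g)(u_f)\le u_{fg}\text{ for all } f,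 g \text{ with } \vartheta_1 f=a,\ \vartheta_1 g=\vartheta_0 f\Big\},$$ ordered componentwise, with, for $r\colon b\to a$, $\mathfrak{z}L(r)\big((u_f)_{\vartheta_1 f=a}\big)=(u_{rh})_{\vartheta_1 h=b}$ and $\Sigma^{\mathfrak{z}L}_r (u_f)_{\vartheta_1 f=b}=\big(\bigvee_{rf=g}u_f\big)_{\vartheta_1 g=a}$. *)

theory Defs
  imports "HOL-Algebra.Galois_Connection" "HOL-Library.FuncSet"
begin

section \<open>Small categories and presheaves\<close>

record ('o, 'm) cat =
  obj :: "'o set"
  arr :: "'m set"
  src :: "'m \<Rightarrow> 'o"
  tgt :: "'m \<Rightarrow> 'o"
  idn :: "'o \<Rightarrow> 'm"
  cmp :: "'m \<Rightarrow> 'm \<Rightarrow> 'm"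

text \<open>\<open>cmp C f g\<close> is the composite \<open>fg\<close> (first \<open>g\<close>, then \<open>f\<close>); it is meaningful only
  if \<open>tgt C g = src C f\<close>. Smallness is automatic, since objects and arrows form sets.\<close>

locale small_category =
  fixes C :: "('o, 'm) cat"
  assumes src_obj: "f \<in> arr C \<Longrightarrow> src C f \<in> obj C"
    and tgt_obj: "f \<in> arr C \<Longrightarrow> tgt C f \<in> obj C"
    and idn_arr: "a \<in> obj C \<Longrightarrow> idn C a \<in> arr C"
    and src_idn: "a \<in> obj C \<Longrightarrow> src C (idn C a) = a"
    and tgt_idn: "a \<in> obj C \<Longrightarrow> tgt C (idn C a) = a"
    and cmp_arr: "\<lbrakk>f \<in> arr C; g \<in> arr C; tgt C g = src C f\<rbrakk> \<Longrightarrow> cmp C f g \<in> arr C"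
    and src_cmp: "\<lbrakk>f \<in> arr C; g \<in> arr C; tgt C g = src C f\<rbrakk> \<Longrightarrow> src C (cmp C f g) = src C g"
    and tgt_cmp: "\<lbrakk>f \<in> arr C; g \<in> arr C; tgt C g = src C f\<rbrakk> \<Longrightarrow> tgt C (cmp C f g) = tgt C f"
    and idn_left: "f \<in> arr C \<Longrightarrow> cmp C (idn C (tgt C f)) f = f"
    and idn_right: "f \<in> arr C \<Longrightarrow> cmp C f (idn C (src C f)) = f"
    and cmp_assoc: "\<lbrakk>f \<in> arr C; g \<in> arr C; h \<in> arr C; tgt C g = src C f; tgt C h = src C g\<rbrakk>
      \<Longrightarrow> cmp C (cmp C f g) h = cmp C f (cmp C g h)"

definition weak_pullback :: "('o, 'm) cat \<Rightarrow> 'm \<Rightarrow> 'm \<Rightarrow> 'm \<Rightarrow> 'm \<Rightarrow> bool" where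
  "weak_pullback C r s p q \<longleftrightarrow>
     r \<in> arr C \<and> s \<in> arr C \<and> p \<in> arr C \<and> q \<in> arr C \<and>
     tgt C r = tgt C s \<and> src C p = src C q \<and> tgt C p = src C r \<and> tgt C q = src C s \<and>
     cmp C r p = cmp C s q \<and>
     (\<forall>p' \<in> arr C. \<forall>q' \<in> arr C.
        src C p' = src C q' \<and> tgt C p' = src C r \<and> tgt C q' = src C s \<and> cmp C r p' = cmp C s q'
        \<longrightarrow> (\<exists>h \<in> arr C. src C h = src C p' \<and> tgt C h = src C p \<and> cmp C p h = p' \<and> cmp C q h = q'))"

definition has_weak_pullbacks :: "('o, 'm) cat \<Rightarrow> bool" where
  "has_weak_pullbacks C \<longleftrightarrow>
     (\<forall>r \<in> arr C. \<forall>s \<in> arr C. tgt C r = tgt C s \<longrightarrow> (\<exists>p q. weak_pullback C r s p q))"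

record ('o, 'm, 'x) psh =
  elts :: "'o \<Rightarrow> 'x set"
  act :: "'m \<Rightarrow> 'x \<Rightarrow> 'x"

locale presheaf =
  fixes C :: "('o, 'm) cat" and X :: "('o, 'm, 'x) psh"
  assumes act_closed: "f \<in> arr C \<Longrightarrow> act X f \<in> elts X (tgt C f) \<rightarrow> elts X (src C f)"
    and act_idn: "\<lbrakk>a \<in> obj C; x \<in> elts X a\<rbrakk> \<Longrightarrow> act X (idn C a) x = x"
    and act_cmp: "\<lbrakk>f \<in> arr C; g \<in> arr C; tgt C g = src C f; x \<in> elts X (tgt C f)\<rbrakk>
      \<Longrightarrow> act X (cmp C f g) x = act X g (act X f x)"

definition nat_trans ::
  "('o, 'm) cat \<Rightarrow> ('o, 'm, 'x) psh \<Rightarrow> ('o, 'm, 'y) psh \<Rightarrow> ('o \<Rightarrow> 'x \<Rightarrow> 'y) \<Rightarrow> bool" where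
  "nat_trans C X Y \<phi> \<longleftrightarrow>
     (\<forall>a \<in> obj C. \<phi> a \<in> elts X a \<rightarrow> elts Y a) \<and>
     (\<forall>f \<in> arr C. \<forall>x \<in> elts X (tgt C f). \<phi> (src C f) (act X f x) = act Y f (\<phi> (tgt C f) x))"

definition prod_psh :: "('o, 'm, 'x) psh \<Rightarrow> ('o, 'm, 'y) psh \<Rightarrow> ('o, 'm, 'x \<times> 'y) psh" where
  "prod_psh X Y = \<lparr>elts = (\<lambda>a. elts X a \<times> elts Y a), act = (\<lambda>f. map_prod (act X f) (act Y f))\<rparr>"

definition yoneda :: "('o, 'm) cat \<Rightarrow> 'o \<Rightarrow> ('o, 'm, 'm) psh" where
  "yoneda C a = \<lparr>elts = (\<lambda>b. {f \<in> arr C. src C f = b \<and> tgt C f = a}), act = (\<lambda>g f. cmp C f g)\<rparr>"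

definition subpresheaf :: "('o, 'm) cat \<Rightarrow> ('o, 'm, 'x) psh \<Rightarrow> ('o \<Rightarrow> 'x set) \<Rightarrow> bool" where
  "subpresheaf C X S \<longleftrightarrow>
     (\<forall>a \<in> obj C. S a \<subseteq> elts X a) \<and> (\<forall>f \<in> arr C. act X f ` S (tgt C f) \<subseteq> S (src C f))"


section \<open>Power-objects in the presheaf topos\<close>

text \<open>The pullback of \<open>E\<close>, a subpresheaf of \<open>X \<times> Q\<close>, along \<open>1 \<times> \<chi> : X \<times> Y \<rightarrow> X \<times> Q\<close>.\<close>

definition pull_rel ::
  "('o, 'm, 'x) psh \<Rightarrow> ('o, 'm, 'y) psh \<Rightarrow> ('o \<Rightarrow> 'y \<Rightarrow> 'q) \<Rightarrow> ('o \<Rightarrow> ('x \<times> 'q) set)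
    \<Rightarrow> 'o \<Rightarrow> ('x \<times> 'y) set" where
  "pull_rel X Y \<chi> E a = {(x, y) \<in> elts X a \<times> elts Y a. (x, \<chi> a y) \<in> E a}"

text \<open>The universal property of \<open>(Q, E)\<close> as power-object of \<open>X\<close> with membership relation \<open>E\<close>:
  every subobject of \<open>X \<times> Y\<close> is the pullback of \<open>E\<close> along \<open>1 \<times> \<chi>\<close> for a unique
  \<open>\<chi> : Y \<rightarrow> Q\<close>. Uniqueness is up to values outside the carriers. The presheaves \<open>Y\<close> take
  their elements from the type \<open>'y\<close>; by the lemma \<open>power_object_any_type\<close> below, the case
  \<open>'y = 'm\<close>, to which the representable presheaves belong, implies all the others.\<close>

definition power_object ::
  "'y itself \<Rightarrow> ('o, 'm) cat \<Rightarrow> ('o, 'm, 'x) psh \<Rightarrow> ('o, 'm, 'q) psh \<Rightarrow> ('o \<Rightarrow> ('x \<times> 'q) set) \<Rightarrow> bool"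
  where
  "power_object T C X Q E \<longleftrightarrow>
     presheaf C Q \<and> subpresheaf C (prod_psh X Q) E \<and>
     (\<forall>(Y :: ('o, 'm, 'y) psh) R. presheaf C Y \<and> subpresheaf C (prod_psh X Y) R \<longrightarrow>
        (\<exists>\<chi>. nat_trans C Y Q \<chi> \<and> (\<forall>a \<in> obj C. R a = pull_rel X Y \<chi> E a)) \<and>
        (\<forall>\<chi> \<chi>'. nat_trans C Y Q \<chi> \<and> (\<forall>a \<in> obj C. R a = pull_rel X Y \<chi> E a) \<and>
                nat_trans C Y Q \<chi>' \<and> (\<forall>a \<in> obj C. R a = pull_rel X Y \<chi>' E a) \<longrightarrow>
                (\<forall>a \<in> obj C. \<forall>y \<in> elts Y a. \<chi> a y = \<chi>' a y)))"

text \<open>The subobject of \<open>X \<times> y(a)\<close> classified by \<open>p \<in> Q(a)\<close>, seen by Yoneda as a map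
  \<open>y(a) \<rightarrow> Q\<close>, and the resulting inclusion order on \<open>Q(a)\<close>.\<close>

definition subobj_of ::
  "('o, 'm) cat \<Rightarrow> ('o, 'm, 'x) psh \<Rightarrow> ('o, 'm, 'q) psh \<Rightarrow> ('o \<Rightarrow> ('x \<times> 'q) set) \<Rightarrow> 'o \<Rightarrow> 'q
    \<Rightarrow> 'o \<Rightarrow> ('x \<times> 'm) set" where
  "subobj_of C X Q E a p = pull_rel X (yoneda C a) (\<lambda>b f. act Q f p) E"

definition power_lat ::
  "('o, 'm) cat \<Rightarrow> ('o, 'm, 'x) psh \<Rightarrow> ('o, 'm, 'q) psh \<Rightarrow> ('o \<Rightarrow> ('x \<times> 'q) set) \<Rightarrow> 'o \<Rightarrow> 'q gorder"
  where
  "power_lat C X Q E a =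
     \<lparr>carrier = elts Q a, eq = (=),
      le = (\<lambda>p q. \<forall>b \<in> obj C. subobj_of C X Q E a p b \<subseteq> subobj_of C X Q E a q b)\<rparr>"


section \<open>Internal suplattices\<close>

record ('o, 'm, 'l) slfun =
  lat :: "'o \<Rightarrow> 'l gorder"
  res :: "'m \<Rightarrow> 'l \<Rightarrow> 'l"

definition suplat_map :: "'k gorder \<Rightarrow> 'l gorder \<Rightarrow> ('k \<Rightarrow> 'l) \<Rightarrow> bool" where
  "suplat_map A B \<phi> \<longleftrightarrow> \<phi> \<in> carrier A \<rightarrow> carrier B \<and> sup_pres A B \<phi>"

text \<open>Functors from the opposite of \<open>C\<close> to complete lattices and sup-preserving maps.\<close>

locale suplat_functor =
  fixes C :: "('o, 'm) cat" and L :: "('o, 'm, 'l, 'z) slfun_scheme"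
  assumes lat_complete: "a \<in> obj C \<Longrightarrow> complete_lattice (lat L a)"
    and res_map: "f \<in> arr C \<Longrightarrow> suplat_map (lat L (tgt C f)) (lat L (src C f)) (res L f)"
    and res_idn: "\<lbrakk>a \<in> obj C; u \<in> carrier (lat L a)\<rbrakk> \<Longrightarrow> res L (idn C a) u = u"
    and res_cmp: "\<lbrakk>f \<in> arr C; g \<in> arr C; tgt C g = src C f; u \<in> carrier (lat L (tgt C f))\<rbrakk>
      \<Longrightarrow> res L (cmp C f g) u = res L g (res L f u)"

definition left_adjoint :: "'k gorder \<Rightarrow> 'l gorder \<Rightarrow> ('k \<Rightarrow> 'l) \<Rightarrow> ('l \<Rightarrow> 'k) \<Rightarrow> bool" where
  "left_adjoint A B l u \<longleftrightarrow>
     galois_connection \<lparr>orderA = A, orderB = B, lower = l, upper = u\<rparr>"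

record ('o, 'm, 'l) isuplat = "('o, 'm, 'l) slfun" +
  sig :: "'m \<Rightarrow> 'l \<Rightarrow> 'l"

locale internal_suplattice =
  small_category C + suplat_functor C L
  for C :: "('o, 'm) cat" and L :: "('o, 'm, 'l) isuplat" +
  assumes sig_adjoint: "f \<in> arr C \<Longrightarrow>
      left_adjoint (lat L (src C f)) (lat L (tgt C f)) (sig L f) (res L f)"
    and beck_chevalley: "\<lbrakk>weak_pullback C r s p q; u \<in> carrier (lat L (src C r))\<rbrakk> \<Longrightarrow>
      res L s (sig L r u) = sig L q (res L p u)"

definition isuplat_morphism ::
  "('o, 'm) cat \<Rightarrow> ('o, 'm, 'k) isuplat \<Rightarrow> ('o, 'm, 'l) isuplat \<Rightarrow> ('o \<Rightarrow> 'k \<Rightarrow> 'l) \<Rightarrow> bool" where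
  "isuplat_morphism C K L \<phi> \<longleftrightarrow>
     (\<forall>a \<in> obj C. suplat_map (lat K a) (lat L a) (\<phi> a)) \<and>
     (\<forall>f \<in> arr C. \<forall>u \<in> carrier (lat K (tgt C f)).
        \<phi> (src C f) (res K f u) = res L f (\<phi> (tgt C f) u)) \<and>
     (\<forall>f \<in> arr C. \<forall>u \<in> carrier (lat K (src C f)).
        \<phi> (tgt C f) (sig K f u) = sig L f (\<phi> (src C f) u))"

definition isuplat_isomorphic ::
  "('o, 'm) cat \<Rightarrow> ('o, 'm, 'k) isuplat \<Rightarrow> ('o, 'm, 'l) isuplat \<Rightarrow> bool" where
  "isuplat_isomorphic C K L \<longleftrightarrow>
     (\<exists>\<phi> \<psi>. isuplat_morphism C K L \<phi> \<and> isuplat_morphism C L K \<psi> \<and>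
        (\<forall>a \<in> obj C. (\<forall>u \<in> carrier (lat K a). \<psi> a (\<phi> a u) = u) \<and>
                     (\<forall>v \<in> carrier (lat L a). \<phi> a (\<psi> a v) = v)))"

text \<open>The suplattice structure of a power-object. A left adjoint of \<open>act Q f\<close> is unique on the
  carrier; that it exists is part of \<open>internal_suplattice\<close> and is not built in here.\<close>

definition power_isuplat ::
  "('o, 'm) cat \<Rightarrow> ('o, 'm, 'x) psh \<Rightarrow> ('o, 'm, 'q) psh \<Rightarrow> ('o \<Rightarrow> ('x \<times> 'q) set) \<Rightarrow> ('o, 'm, 'q) isuplat"
  where
  "power_isuplat C X Q E =
     \<lparr>lat = power_lat C X Q E,
      res = act Q,
      sig = (\<lambda>f. SOME l. left_adjoint (power_lat C X Q E (src C f)) (power_lat C X Q E (tgt C f))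
                           l (act Q f))\<rparr>"


section \<open>The constructions \<open>P \<circ> X\<close> and \<open>\<zz>L\<close>\<close>

definition powerset_lat :: "'x set \<Rightarrow> 'x set gorder" where
  "powerset_lat A = \<lparr>carrier = Pow A, eq = (=), le = (\<subseteq>)\<rparr>"

definition pow_comp :: "('o, 'm, 'x) psh \<Rightarrow> ('o, 'm, 'x set) slfun" where
  "pow_comp X = \<lparr>lat = (\<lambda>a. powerset_lat (elts X a)), res = (\<lambda>f U. act X f ` U)\<rparr>"

definition into :: "('o, 'm) cat \<Rightarrow> 'o \<Rightarrow> 'm set" where
  "into C a = {f \<in> arr C. tgt C f = a}"

definition zed_lat ::
  "('o, 'm) cat \<Rightarrow> ('o, 'm, 'l, 'z) slfun_scheme \<Rightarrow> 'o \<Rightarrow> ('m \<Rightarrow> 'l) gorder" where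
  "zed_lat C L a =
     \<lparr>carrier = {u \<in> \<Pi>\<^sub>E f \<in> into C a. carrier (lat L (src C f)).
        \<forall>f \<in> into C a. \<forall>g \<in> into C (src C f).
          res L g (u f) \<sqsubseteq>\<^bsub>lat L (src C g)\<^esub> u (cmp C f g)},
      eq = (=),
      le = (\<lambda>u v. \<forall>f \<in> into C a. u f \<sqsubseteq>\<^bsub>lat L (src C f)\<^esub> v f)\<rparr>"

definition zed :: "('o, 'm) cat \<Rightarrow> ('o, 'm, 'l, 'z) slfun_scheme \<Rightarrow> ('o, 'm, 'm \<Rightarrow> 'l) isuplat" where
  "zed C L =
     \<lparr>lat = zed_lat C L,
      res = (\<lambda>r u. \<lambda>h \<in> into C (src C r). u (cmp C r h)),
      sig = (\<lambda>r u. \<lambda>g \<in> into C (tgt C r).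
        \<Squnion>\<^bsub>lat L (src C g)\<^esub> {u f | f. f \<in> into C (src C r) \<and> cmp C r f = g})\<rparr>"


section \<open>Basic facts\<close>

lemma powerset_sup_is:
  assumes "F \<subseteq> Pow A"
  shows "least (powerset_lat A) (\<Union>F) (Upper (powerset_lat A) F)"
  using assms unfolding least_def Upper_def powerset_lat_def by simp blast

lemma powerset_complete: "complete_lattice (powerset_lat A)"
proof -
  have po: "partial_order (powerset_lat A)"
    by unfold_locales (auto simp: powerset_lat_def)
  show ?thesis
  proof (rule complete_lattice.intro[OF po], unfold_locales)
    fix F assume F: "F \<subseteq> carrier (powerset_lat A)"
    then have "F \<subseteq> Pow A" by (simp add: powerset_lat_def)
    then show "\<exists>s. least (powerset_lat A) s (Upper (powerset_lat A) F)"
      using powerset_sup_is by blast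
    have "greatest (powerset_lat A) (A \<inter> \<Inter>F) (Lower (powerset_lat A) F)"
      using \<open>F \<subseteq> Pow A\<close> unfolding greatest_def Lower_def powerset_lat_def by simp blast
    then show "\<exists>i. greatest (powerset_lat A) i (Lower (powerset_lat A) F)" by blast
  qed
qed

lemma powerset_sup:
  assumes "F \<subseteq> Pow A" shows "\<Squnion>\<^bsub>powerset_lat A\<^esub> F = \<Union>F"
proof -
  interpret complete_lattice "powerset_lat A" by (rule powerset_complete)
  show ?thesis
    using powerset_sup_is[OF assms] least_unique sup_lub assms
    by (metis (no_types, lifting) partial_object.select_convs(1) powerset_lat_def)
qed

lemma pow_comp_suplat_functor:
  assumes "small_category C" "presheaf C X"
  shows "suplat_functor C (pow_comp X)"
proof -
  interpret small_category C by fact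
  interpret presheaf C X by fact
  show ?thesis
  proof (rule suplat_functor.intro)
    fix a assume "a \<in> obj C"
    show "complete_lattice (lat (pow_comp X) a)"
      by (simp add: pow_comp_def powerset_complete)
  next
    fix f assume f: "f \<in> arr C"
    have cl: "act X f ` U \<subseteq> elts X (src C f)" if "U \<subseteq> elts X (tgt C f)" for U
      using act_closed[OF f] that by auto
    have "act X f ` (\<Squnion>\<^bsub>powerset_lat (elts X (tgt C f))\<^esub> F) =
        \<Squnion>\<^bsub>powerset_lat (elts X (src C f))\<^esub> ((\<lambda>U. act X f ` U) ` F)"
      if F: "F \<subseteq> Pow (elts X (tgt C f))" for F
    proof -
      have G: "(\<lambda>U. act X f ` U) ` F \<subseteq> Pow (elts X (src C f))" using F cl by blast
      show ?thesis unfolding powerset_sup[OF F] powerset_sup[OF G] by (rule image_Union)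
    qed
    then show "suplat_map (lat (pow_comp X) (tgt C f)) (lat (pow_comp X) (src C f)) (res (pow_comp X) f)"
      using cl powerset_complete
      by (auto simp: suplat_map_def sup_pres_def pow_comp_def) (auto simp: powerset_lat_def)
  next
    fix a u assume "a \<in> obj C" "u \<in> carrier (lat (pow_comp X) a)"
    then show "res (pow_comp X) (idn C a) u = u"
      using act_idn by (force simp: pow_comp_def powerset_lat_def)
  next
    fix f g u assume "f \<in> arr C" "g \<in> arr C" "tgt C g = src C f"
      "u \<in> carrier (lat (pow_comp X) (tgt C f))"
    then show "res (pow_comp X) (cmp C f g) u = res (pow_comp X) g (res (pow_comp X) f u)"
      using act_cmp by (force simp: pow_comp_def powerset_lat_def image_image)
  qed
qed

lemma yoneda_presheaf:
  assumes "small_category C" "a \<in> obj C"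
  shows "presheaf C (yoneda C a)"
proof -
  interpret small_category C by fact
  show ?thesis
    by unfold_locales
      (auto simp: yoneda_def cmp_arr src_cmp tgt_cmp cmp_assoc idn_right)
qed

lemma pull_rel_subpresheaf:
  assumes "presheaf C X" "presheaf C Y" "nat_trans C Y Q \<chi>" "subpresheaf C (prod_psh X Q) E"
  shows "subpresheaf C (prod_psh X Y) (pull_rel X Y \<chi> E)"
proof -
  interpret X: presheaf C X by fact
  interpret Y: presheaf C Y by fact
  show ?thesis
    unfolding subpresheaf_def
  proof (intro conjI ballI)
    fix a assume "a \<in> obj C"
    show "pull_rel X Y \<chi> E a \<subseteq> elts (prod_psh X Y) a"
      by (auto simp: pull_rel_def prod_psh_def)
  next
    fix f assume f: "f \<in> arr C"
    show "act (prod_psh X Y) f ` pull_rel X Y \<chi> E (tgt C f) \<subseteq> pull_rel X Y \<chi> E (src C f)"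
    proof (rule image_subsetI)
      fix z assume "z \<in> pull_rel X Y \<chi> E (tgt C f)"
      then obtain x y where z: "z = (x, y)" and x: "x \<in> elts X (tgt C f)" and y: "y \<in> elts Y (tgt C f)"
        and e: "(x, \<chi> (tgt C f) y) \<in> E (tgt C f)" by (auto simp: pull_rel_def)
      have "act (prod_psh X Q) f (x, \<chi> (tgt C f) y) \<in> E (src C f)"
        using assms(4) f e unfolding subpresheaf_def by blast
      then have "(act X f x, act Q f (\<chi> (tgt C f) y)) \<in> E (src C f)" by (simp add: prod_psh_def)
      moreover have "act Q f (\<chi> (tgt C f) y) = \<chi> (src C f) (act Y f y)"
        using assms(3) f y unfolding nat_trans_def by simp
      ultimately have "(act X f x, act Y f y) \<in> pull_rel X Y \<chi> E (src C f)"
        using X.act_closed[OF f] Y.act_closed[OF f] x y by (auto simp: pull_rel_def)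
      then show "act (prod_psh X Y) f z \<in> pull_rel X Y \<chi> E (src C f)"
        by (simp add: z prod_psh_def)
    qed
  qed
qed

lemma yoneda_nat_trans:
  assumes "small_category C" "presheaf C Q" "a \<in> obj C" "p \<in> elts Q a"
  shows "nat_trans C (yoneda C a) Q (\<lambda>b f. act Q f p)"
proof -
  interpret small_category C by fact
  interpret Q: presheaf C Q by fact
  show ?thesis
    unfolding nat_trans_def yoneda_def using Q.act_closed Q.act_cmp assms(4) by auto
qed

text \<open>Power-objects with respect to presheaves with elements of type \<open>'m\<close> are power-objects with
  respect to presheaves with elements of any type.\<close>

lemma power_object_any_type:
  fixes C :: "('o, 'm) cat"
  assumes C: "small_category C" and X: "presheaf C X" and PO: "power_object TYPE('m) C X Q E"
  shows "power_object TYPE('y) C X Q E"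
proof -
  interpret small_category C by fact
  interpret X: presheaf C X by fact
  have Q: "presheaf C Q" and E: "subpresheaf C (prod_psh X Q) E"
    using PO by (auto simp: power_object_def)
  interpret Q: presheaf C Q by fact
  have PO_ex: "\<exists>\<chi>. nat_trans C Y Q \<chi> \<and> (\<forall>a \<in> obj C. R a = pull_rel X Y \<chi> E a)"
    if "presheaf C Y" "subpresheaf C (prod_psh X Y) R" for Y :: "('o, 'm, 'm) psh" and R
    using PO that by (simp add: power_object_def)
  have PO_uniq: "\<chi> a y = \<chi>' a y"
    if "presheaf C Y" "subpresheaf C (prod_psh X Y) R"
      "nat_trans C Y Q \<chi>" "\<forall>a \<in> obj C. R a = pull_rel X Y \<chi> E a"
      "nat_trans C Y Q \<chi>'" "\<forall>a \<in> obj C. R a = pull_rel X Y \<chi>' E a"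
      "a \<in> obj C" "y \<in> elts Y a" for Y :: "('o, 'm, 'm) psh" and R \<chi> \<chi>' a y
  proof -
    have "(\<forall>\<chi> \<chi>'. nat_trans C Y Q \<chi> \<and> (\<forall>a \<in> obj C. R a = pull_rel X Y \<chi> E a) \<and>
        nat_trans C Y Q \<chi>' \<and> (\<forall>a \<in> obj C. R a = pull_rel X Y \<chi>' E a) \<longrightarrow>
        (\<forall>a \<in> obj C. \<forall>y \<in> elts Y a. \<chi> a y = \<chi>' a y))"
      using PO that(1,2) unfolding power_object_def by blast
    then show ?thesis using that(3-8) by blast
  qed
  have uniq: "p = q" if a: "a \<in> obj C" and p: "p \<in> elts Q a" and q: "q \<in> elts Q a"
    and eq: "\<And>b. b \<in> obj C \<Longrightarrow> subobj_of C X Q E a p b = subobj_of C X Q E a q b" for a p q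
  proof -
    let ?\<chi> = "\<lambda>p (b::'o) f. act Q f p"
    have np: "nat_trans C (yoneda C a) Q (?\<chi> p)" and nq: "nat_trans C (yoneda C a) Q (?\<chi> q)"
      using yoneda_nat_trans[OF C Q a] p q by auto
    have sub: "subpresheaf C (prod_psh X (yoneda C a)) (subobj_of C X Q E a p)"
      unfolding subobj_of_def
      by (rule pull_rel_subpresheaf[OF X yoneda_presheaf[OF C a] np E])
    have "idn C a \<in> elts (yoneda C a) a"
      using a idn_arr src_idn tgt_idn by (simp add: yoneda_def)
    then have "?\<chi> p a (idn C a) = ?\<chi> q a (idn C a)"
      using eq a by (intro PO_uniq[OF yoneda_presheaf[OF C a] sub np _ nq])
        (auto simp: subobj_of_def)
    then show "p = q" using Q.act_idn a p q by simp
  qed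
  have ex: "\<exists>p \<in> elts Q a. \<forall>b \<in> obj C. S b = subobj_of C X Q E a p b"
    if a: "a \<in> obj C" and S: "subpresheaf C (prod_psh X (yoneda C a)) S" for a S
  proof -
    obtain \<chi> where n: "nat_trans C (yoneda C a) Q \<chi>"
      and c: "\<forall>b \<in> obj C. S b = pull_rel X (yoneda C a) \<chi> E b"
      using PO_ex[OF yoneda_presheaf[OF C a] S] by blast
    have i: "idn C a \<in> elts (yoneda C a) a"
      using a idn_arr src_idn tgt_idn by (simp add: yoneda_def)
    let ?p = "\<chi> a (idn C a)"
    have p: "?p \<in> elts Q a" using n a i unfolding nat_trans_def by auto
    have "\<chi> b f = act Q f ?p" if "b \<in> obj C" "f \<in> elts (yoneda C a) b" for b f
    proof -
      have f: "f \<in> arr C" "src C f = b" "tgt C f = a" using that by (auto simp: yoneda_def)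
      then have "\<chi> b (act (yoneda C a) f (idn C a)) = act Q f ?p"
        using n i unfolding nat_trans_def by blast
      then show ?thesis using f idn_left by (auto simp: yoneda_def)
    qed
    then have "\<forall>b \<in> obj C. S b = subobj_of C X Q E a ?p b"
      using c by (auto simp: subobj_of_def pull_rel_def)
    then show ?thesis using p by blast
  qed
  have key: "subobj_of C X Q E a (\<chi> a y) b = {(x, f). x \<in> elts X b \<and> f \<in> elts (yoneda C a) b \<and> (x, act Y f y) \<in> R b}"
    if "a \<in> obj C" "b \<in> obj C" "y \<in> elts Y a" "presheaf C Y" "nat_trans C Y Q \<chi>"
      and R: "\<forall>a \<in> obj C. R a = pull_rel X Y \<chi> E a"
    for a b y \<chi> and Y :: "('o, 'm, 'y) psh" and R
  proof -
    interpret Y: presheaf C Y by fact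
    have "act Q f (\<chi> a y) = \<chi> b (act Y f y) \<and> act Y f y \<in> elts Y b"
      if "f \<in> elts (yoneda C a) b" for f
      using that \<open>nat_trans C Y Q \<chi>\<close> \<open>y \<in> elts Y a\<close> Y.act_closed
      unfolding nat_trans_def yoneda_def by fastforce
    then show ?thesis using R \<open>b \<in> obj C\<close> by (auto simp: subobj_of_def pull_rel_def)
  qed
  show ?thesis
    unfolding power_object_def
  proof (intro conjI allI impI ballI Q E; (elim conjE)?)
    fix Y :: "('o, 'm, 'y) psh" and R
    assume Y: "presheaf C Y" and R: "subpresheaf C (prod_psh X Y) R"
    interpret Y: presheaf C Y by fact
    define S where "S a y b = {(x, f). x \<in> elts X b \<and> f \<in> elts (yoneda C a) b \<and> (x, act Y f y) \<in> R b}"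
      for a y b
    have Ract: "(act X f x, act Y f y) \<in> R (src C f)" if "f \<in> arr C" "(x, y) \<in> R (tgt C f)" for f x y
    proof -
      have "act (prod_psh X Y) f (x, y) \<in> R (src C f)" using R that unfolding subpresheaf_def by blast
      then show ?thesis by (simp add: prod_psh_def)
    qed
    have S: "subpresheaf C (prod_psh X (yoneda C a)) (S a y)" if "a \<in> obj C" "y \<in> elts Y a" for a y
      unfolding subpresheaf_def
    proof (intro conjI ballI)
      fix b assume "b \<in> obj C"
      show "S a y b \<subseteq> elts (prod_psh X (yoneda C a)) b" by (auto simp: S_def prod_psh_def)
    next
      fix g assume g: "g \<in> arr C"
      show "act (prod_psh X (yoneda C a)) g ` S a y (tgt C g) \<subseteq> S a y (src C g)"
      proof (rule image_subsetI)
        fix z assume "z \<in> S a y (tgt C g)"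
        then obtain x f where z: "z = (x, f)" and *: "x \<in> elts X (tgt C g)" "f \<in> arr C" "src C f = tgt C g" "tgt C f = a"
          "(x, act Y f y) \<in> R (tgt C g)" by (auto simp: S_def yoneda_def)
        have "(act X g x, act Y (cmp C f g) y) \<in> R (src C g)"
          using Ract[OF g *(5)] Y.act_cmp[of f g y] * g that by simp
        then show "act (prod_psh X (yoneda C a)) g z \<in> S a y (src C g)"
          unfolding z using * g X.act_closed[OF g]
          by (auto simp: S_def prod_psh_def yoneda_def cmp_arr src_cmp tgt_cmp)
      qed
    qed
    define \<chi> where "\<chi> a y = (SOME p. p \<in> elts Q a \<and> (\<forall>b \<in> obj C. S a y b = subobj_of C X Q E a p b))"
      for a y
    have \<chi>: "\<chi> a y \<in> elts Q a \<and> (\<forall>b \<in> obj C. S a y b = subobj_of C X Q E a (\<chi> a y) b)"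
      if "a \<in> obj C" "y \<in> elts Y a" for a y
      unfolding \<chi>_def using ex[OF that(1) S[OF that]] by - (rule someI_ex, blast)
    have nat: "nat_trans C Y Q \<chi>"
      unfolding nat_trans_def
    proof (intro conjI ballI)
      fix a assume "a \<in> obj C" then show "\<chi> a \<in> elts Y a \<rightarrow> elts Q a" using \<chi> by blast
    next
      fix f y assume f: "f \<in> arr C" and y: "y \<in> elts Y (tgt C f)"
      note o = src_obj[OF f] tgt_obj[OF f]
      have y': "act Y f y \<in> elts Y (src C f)" using Y.act_closed[OF f] y by blast
      have q: "act Q f (\<chi> (tgt C f) y) \<in> elts Q (src C f)"
        using Q.act_closed[OF f] \<chi>[OF o(2) y] by blast
      show "\<chi> (src C f) (act Y f y) = act Q f (\<chi> (tgt C f) y)"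
      proof (rule uniq[OF o(1)])
        show "\<chi> (src C f) (act Y f y) \<in> elts Q (src C f)" using \<chi>[OF o(1) y'] by blast
        show "act Q f (\<chi> (tgt C f) y) \<in> elts Q (src C f)" by (rule q)
        fix b assume b: "b \<in> obj C"
        have "(x, g) \<in> S (src C f) (act Y f y) b \<longleftrightarrow>
              (x, g) \<in> subobj_of C X Q E (src C f) (act Q f (\<chi> (tgt C f) y)) b" for x g
        proof (cases "g \<in> arr C \<and> src C g = b \<and> tgt C g = src C f")
          case True
          then have g: "g \<in> arr C" "src C g = b" "tgt C g = src C f" by auto
          have "(x, g) \<in> S (src C f) (act Y f y) b \<longleftrightarrow> (x, cmp C f g) \<in> S (tgt C f) y b"
            using f g y Y.act_cmp[OF f g(1) g(3) y]
            by (simp add: S_def yoneda_def cmp_arr src_cmp tgt_cmp)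
          also have "\<dots> \<longleftrightarrow> (x, cmp C f g) \<in> subobj_of C X Q E (tgt C f) (\<chi> (tgt C f) y) b"
            using \<chi>[OF o(2) y] b by simp
          also have "\<dots> \<longleftrightarrow> (x, g) \<in> subobj_of C X Q E (src C f) (act Q f (\<chi> (tgt C f) y)) b"
            using f g Q.act_cmp[OF f g(1) g(3)] \<chi>[OF o(2) y]
            by (simp add: subobj_of_def pull_rel_def yoneda_def cmp_arr src_cmp tgt_cmp)
          finally show ?thesis .
        next
          case False
          then show ?thesis by (auto simp: S_def subobj_of_def pull_rel_def yoneda_def)
        qed
        then show "subobj_of C X Q E (src C f) (\<chi> (src C f) (act Y f y)) b =
            subobj_of C X Q E (src C f) (act Q f (\<chi> (tgt C f) y)) b"
          using \<chi>[OF o(1) y'] b by auto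
      qed
    qed
    have "R a = pull_rel X Y \<chi> E a" if a: "a \<in> obj C" for a
    proof -
      have Ra: "R a \<subseteq> elts X a \<times> elts Y a" using R a by (auto simp: subpresheaf_def prod_psh_def)
      have "(x, y) \<in> R a \<longleftrightarrow> (x, \<chi> a y) \<in> E a" if x: "x \<in> elts X a" and y: "y \<in> elts Y a" for x y
      proof -
        have i: "idn C a \<in> elts (yoneda C a) a"
          using a idn_arr src_idn tgt_idn by (simp add: yoneda_def)
        have "(x, y) \<in> R a \<longleftrightarrow> (x, idn C a) \<in> S a y a"
          using x i Y.act_idn[OF a y] by (simp add: S_def)
        also have "\<dots> \<longleftrightarrow> (x, idn C a) \<in> subobj_of C X Q E a (\<chi> a y) a" using \<chi>[OF a y] a by simp
        also have "\<dots> \<longleftrightarrow> (x, \<chi> a y) \<in> E a"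
          using x i Q.act_idn[OF a, of "\<chi> a y"] \<chi>[OF a y] by (simp add: subobj_of_def pull_rel_def)
        finally show ?thesis .
      qed
      then show ?thesis using Ra by (auto simp: pull_rel_def)
    qed
    then show "\<exists>\<chi>. nat_trans C Y Q \<chi> \<and> (\<forall>a \<in> obj C. R a = pull_rel X Y \<chi> E a)" using nat by blast
  next
    fix Y :: "('o, 'm, 'y) psh" and R \<chi> \<chi>' a y
    assume "presheaf C Y" "nat_trans C Y Q \<chi>" "nat_trans C Y Q \<chi>'" "a \<in> obj C" "y \<in> elts Y a"
      "\<forall>a \<in> obj C. R a = pull_rel X Y \<chi> E a" "\<forall>a \<in> obj C. R a = pull_rel X Y \<chi>' E a"
    then show "\<chi> a y = \<chi>' a y"
      using key[of a _ y Y \<chi> R] key[of a _ y Y \<chi>' R]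
      by (intro uniq) (auto simp: nat_trans_def)
  qed
qed

text \<open>Every presheaf has a power-object, namely \<open>a \<mapsto> Sub(X \<times> y(a))\<close>.\<close>

definition sub_psh :: "('o, 'm) cat \<Rightarrow> ('o, 'm, 'x) psh \<Rightarrow> ('o, 'm, 'o \<Rightarrow> ('x \<times> 'm) set) psh" where
  "sub_psh C X =
     \<lparr>elts = (\<lambda>a. {S. subpresheaf C (prod_psh X (yoneda C a)) S \<and> (\<forall>b. b \<notin> obj C \<longrightarrow> S b = {})}),
      act = (\<lambda>f S b. {(x, g). g \<in> elts (yoneda C (src C f)) b \<and> (x, cmp C f g) \<in> S b})\<rparr>"

definition sub_mem :: "('o, 'm) cat \<Rightarrow> ('o, 'm, 'x) psh \<Rightarrow> 'o \<Rightarrow> ('x \<times> ('o \<Rightarrow> ('x \<times> 'm) set)) set" where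
  "sub_mem C X a = {(x, S). x \<in> elts X a \<and> S \<in> elts (sub_psh C X) a \<and> (x, idn C a) \<in> S a}"

lemma sub_psh_power_object:
  fixes C :: "('o, 'm) cat" and X :: "('o, 'm, 'x) psh"
  assumes C: "small_category C" and X: "presheaf C X"
  shows "power_object TYPE('y) C X (sub_psh C X) (sub_mem C X)"
proof -
  interpret small_category C by fact
  interpret X: presheaf C X by fact
  let ?Q = "sub_psh C X" and ?E = "sub_mem C X"
  have elD: "x \<in> elts X b \<and> f \<in> arr C \<and> src C f = b \<and> tgt C f = a"
    if "S \<in> elts ?Q a" "(x, f) \<in> S b" for S a b x f
  proof -
    have "b \<in> obj C" using that by (auto simp: sub_psh_def)
    then have "(x, f) \<in> elts (prod_psh X (yoneda C a)) b"
      using that unfolding sub_psh_def subpresheaf_def by auto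
    then show ?thesis by (simp add: prod_psh_def yoneda_def)
  qed
  have elR: "(act X g x, cmp C f g) \<in> S (src C g)"
    if "S \<in> elts ?Q a" "(x, f) \<in> S (tgt C g)" "g \<in> arr C" for S a x f g
  proof -
    have "act (prod_psh X (yoneda C a)) g (x, f) \<in> S (src C g)"
    proof -
      have "subpresheaf C (prod_psh X (yoneda C a)) S" using that(1) by (simp add: sub_psh_def)
      then show ?thesis using that(2,3) unfolding subpresheaf_def by blast
    qed
    then show ?thesis by (simp add: prod_psh_def yoneda_def)
  qed
  have elI: "S \<in> elts ?Q a"
    if 1: "\<And>b x f. (x, f) \<in> S b \<Longrightarrow> x \<in> elts X b \<and> f \<in> arr C \<and> src C f = b \<and> tgt C f = a"
      and 2: "\<And>x f g. \<lbrakk>(x, f) \<in> S (tgt C g); g \<in> arr C\<rbrakk> \<Longrightarrow> (act X g x, cmp C f g) \<in> S (src C g)" for S a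
  proof -
    have "S b = {}" if "b \<notin> obj C" for b
    proof -
      have "(x, f) \<notin> S b" for x f using that 1[of x f b] src_obj by blast
      then show ?thesis by auto
    qed
    moreover have "subpresheaf C (prod_psh X (yoneda C a)) S"
      unfolding subpresheaf_def using 1 2 by (auto simp: prod_psh_def yoneda_def)
    ultimately show ?thesis by (simp add: sub_psh_def)
  qed
  have actE: "(x, g) \<in> act ?Q f S b \<longleftrightarrow>
      g \<in> arr C \<and> src C g = b \<and> tgt C g = src C f \<and> (x, cmp C f g) \<in> S b" for x g f S b
    by (auto simp: sub_psh_def yoneda_def)
  have Q: "presheaf C ?Q"
  proof
    fix f assume f: "f \<in> arr C"
    show "act ?Q f \<in> elts ?Q (tgt C f) \<rightarrow> elts ?Q (src C f)"
    proof
      fix S assume S: "S \<in> elts ?Q (tgt C f)"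
      show "act ?Q f S \<in> elts ?Q (src C f)"
      proof (rule elI)
        fix b x g assume "(x, g) \<in> act ?Q f S b"
        then show "x \<in> elts X b \<and> g \<in> arr C \<and> src C g = b \<and> tgt C g = src C f"
          using elD[OF S] by (auto simp: actE)
      next
        fix x g h assume *: "(x, g) \<in> act ?Q f S (tgt C h)" and h: "h \<in> arr C"
        then show "(act X h x, cmp C g h) \<in> act ?Q f S (src C h)"
          using elR[OF S _ h, of x "cmp C f g"] f
          by (auto simp: actE cmp_arr src_cmp tgt_cmp cmp_assoc)
      qed
    qed
  next
    fix a S assume a: "a \<in> obj C" and S: "S \<in> elts ?Q a"
    have "(x, g) \<in> act ?Q (idn C a) S b \<longleftrightarrow> (x, g) \<in> S b" for x g b
      using elD[OF S, of x g b] idn_left[of g] src_idn[OF a] by (auto simp: actE)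
    then show "act ?Q (idn C a) S = S" by (intro ext) auto
  next
    fix f g S assume fg: "f \<in> arr C" "g \<in> arr C" "tgt C g = src C f" and S: "S \<in> elts ?Q (tgt C f)"
    have "(x, h) \<in> act ?Q (cmp C f g) S b \<longleftrightarrow> (x, h) \<in> act ?Q g (act ?Q f S) b" for x h b
      using fg by (auto simp: actE cmp_arr src_cmp tgt_cmp cmp_assoc)
    then show "act ?Q (cmp C f g) S = act ?Q g (act ?Q f S)" by (intro ext) auto
  qed
  interpret Q: presheaf C ?Q by fact
  have actmem: "(x, idn C (src C f)) \<in> act ?Q f S (src C f) \<longleftrightarrow> (x, f) \<in> S (src C f)"
    if "f \<in> arr C" for f x S
    using that src_obj by (auto simp: actE idn_arr src_idn tgt_idn idn_right)
  have E: "subpresheaf C (prod_psh X ?Q) ?E"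
    unfolding subpresheaf_def
  proof (intro conjI ballI)
    fix a assume "a \<in> obj C"
    show "?E a \<subseteq> elts (prod_psh X ?Q) a" by (auto simp: sub_mem_def prod_psh_def)
  next
    fix f assume f: "f \<in> arr C"
    show "act (prod_psh X ?Q) f ` ?E (tgt C f) \<subseteq> ?E (src C f)"
    proof (rule image_subsetI)
      fix z assume "z \<in> ?E (tgt C f)"
      then obtain x S where z: "z = (x, S)" and *: "x \<in> elts X (tgt C f)" "S \<in> elts ?Q (tgt C f)" "(x, idn C (tgt C f)) \<in> S (tgt C f)"
        by (auto simp: sub_mem_def)
      have "(act X f x, f) \<in> S (src C f)" using elR[OF *(2,3) f] idn_left[OF f] by simp
      then show "act (prod_psh X ?Q) f z \<in> ?E (src C f)"
        unfolding z using X.act_closed[OF f] Q.act_closed[OF f] * actmem[OF f]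
        by (auto simp: prod_psh_def sub_mem_def)
    qed
  qed
  show ?thesis
    unfolding power_object_def
  proof (intro conjI allI impI ballI Q E; (elim conjE)?)
    fix Y :: "('o, 'm, 'y) psh" and R
    assume Y: "presheaf C Y" and R: "subpresheaf C (prod_psh X Y) R"
    interpret Y: presheaf C Y by fact
    have Rsub: "x \<in> elts X a \<and> y \<in> elts Y a" if "a \<in> obj C" "(x, y) \<in> R a" for a x y
      using R that unfolding subpresheaf_def prod_psh_def by auto
    have Ract: "(act X f x, act Y f y) \<in> R (src C f)" if "f \<in> arr C" "(x, y) \<in> R (tgt C f)" for f x y
    proof -
      have "act (prod_psh X Y) f (x, y) \<in> R (src C f)" using R that unfolding subpresheaf_def by blast
      then show ?thesis by (simp add: prod_psh_def)
    qed
    define \<chi> where "\<chi> a y b = {(x, f). f \<in> elts (yoneda C a) b \<and> (x, act Y f y) \<in> R b}" for a y b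
    have \<chi>E: "(x, f) \<in> \<chi> a y b \<longleftrightarrow> f \<in> arr C \<and> src C f = b \<and> tgt C f = a \<and> (x, act Y f y) \<in> R b"
      for x f a y b by (auto simp: \<chi>_def yoneda_def)
    have \<chi>Q: "\<chi> a y \<in> elts ?Q a" if y: "y \<in> elts Y a" for a y
    proof (rule elI)
      fix b x f assume "(x, f) \<in> \<chi> a y b"
      then show "x \<in> elts X b \<and> f \<in> arr C \<and> src C f = b \<and> tgt C f = a"
        using Rsub src_obj by (auto simp: \<chi>E)
    next
      fix x f g assume "(x, f) \<in> \<chi> a y (tgt C g)" "g \<in> arr C"
      then show "(act X g x, cmp C f g) \<in> \<chi> a y (src C g)"
        using Ract[of g x "act Y f y"] Y.act_cmp[of f g y] y
        by (auto simp: \<chi>E cmp_arr src_cmp tgt_cmp)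
    qed
    have nat: "nat_trans C Y ?Q \<chi>"
      unfolding nat_trans_def
    proof (intro conjI ballI)
      fix a assume "a \<in> obj C" show "\<chi> a \<in> elts Y a \<rightarrow> elts ?Q a" using \<chi>Q by blast
    next
      fix f y assume f: "f \<in> arr C" and y: "y \<in> elts Y (tgt C f)"
      have "(x, g) \<in> \<chi> (src C f) (act Y f y) b \<longleftrightarrow> (x, g) \<in> act ?Q f (\<chi> (tgt C f) y) b" for x g b
        using f y Y.act_cmp[OF f, of g y] by (auto simp: \<chi>E actE cmp_arr src_cmp tgt_cmp)
      then show "\<chi> (src C f) (act Y f y) = act ?Q f (\<chi> (tgt C f) y)" by (intro ext) auto
    qed
    have "R a = pull_rel X Y \<chi> ?E a" if a: "a \<in> obj C" for a
    proof -
      have "(x, y) \<in> R a \<longleftrightarrow> (x, y) \<in> pull_rel X Y \<chi> ?E a" for x y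
        using Rsub[OF a, of x y] \<chi>Q[of y a] Y.act_idn[OF a, of y] a
        by (auto simp: pull_rel_def sub_mem_def \<chi>E idn_arr src_idn tgt_idn)
      then show ?thesis by auto
    qed
    then show "\<exists>\<chi>. nat_trans C Y ?Q \<chi> \<and> (\<forall>a \<in> obj C. R a = pull_rel X Y \<chi> ?E a)" using nat by blast
  next
    fix Y :: "('o, 'm, 'y) psh" and R \<chi> \<chi>' a y
    assume Y: "presheaf C Y" and n: "nat_trans C Y ?Q \<chi>" and n': "nat_trans C Y ?Q \<chi>'"
      and a: "a \<in> obj C" and y: "y \<in> elts Y a"
      and R: "\<forall>a \<in> obj C. R a = pull_rel X Y \<chi> ?E a" and R': "\<forall>a \<in> obj C. R a = pull_rel X Y \<chi>' ?E a"
    interpret Y: presheaf C Y by fact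
    have char: "(x, f) \<in> \<psi> a y b \<longleftrightarrow> f \<in> arr C \<and> src C f = b \<and> tgt C f = a \<and> (x, act Y f y) \<in> R b"
      if m: "nat_trans C Y ?Q \<psi>" and r: "\<forall>a \<in> obj C. R a = pull_rel X Y \<psi> ?E a" for x f b \<psi>
    proof (cases "f \<in> arr C \<and> src C f = b \<and> tgt C f = a")
      case True
      then have f: "f \<in> arr C" "src C f = b" "tgt C f = a" by auto
      then have b: "b \<in> obj C" using src_obj by auto
      have q: "\<psi> a y \<in> elts ?Q a" using m a y unfolding nat_trans_def by blast
      have y': "act Y f y \<in> elts Y b" using Y.act_closed[OF f(1)] f y by blast
      have q': "\<psi> b (act Y f y) \<in> elts ?Q b" using m b y' unfolding nat_trans_def by blast
      have eq: "\<psi> b (act Y f y) = act ?Q f (\<psi> a y)" using m f y unfolding nat_trans_def by blast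
      have "(x, act Y f y) \<in> R b \<longleftrightarrow> x \<in> elts X b \<and> (x, idn C b) \<in> \<psi> b (act Y f y) b"
        using r b y' q' by (auto simp: pull_rel_def sub_mem_def)
      also have "\<dots> \<longleftrightarrow> x \<in> elts X b \<and> (x, f) \<in> \<psi> a y b" using eq actmem[OF f(1), of x "\<psi> a y"] f by simp
      also have "\<dots> \<longleftrightarrow> (x, f) \<in> \<psi> a y b" using elD[OF q, of x f b] by blast
      finally show ?thesis using f by blast
    next
      case False
      have q: "\<psi> a y \<in> elts ?Q a" using m a y unfolding nat_trans_def by blast
      show ?thesis using False elD[OF q, of x f b] by blast
    qed
    show "\<chi> a y = \<chi>' a y"
      using char[OF n R] char[OF n' R'] by (intro ext) auto
  qed
qed

end

theory Submission
  imports Defs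
begin

text \<open>
  By Yoneda, an element of \<open>P X\<close> at stage \<open>a\<close> is a map \<open>y(a) \<rightarrow> P X\<close>, that is, a subobject
  of \<open>X \<times> y(a)\<close>. The fibres of such a subobject over the arrows \<open>f\<close> into \<open>a\<close> are
  subsets \<open>U f\<close> of \<open>X (src f)\<close>, and being closed under the action of an arrow \<open>g\<close> means
  exactly that the image of \<open>U f\<close> under \<open>X g\<close> lies in \<open>U (fg)\<close>. This is the inequality that
  defines \<open>\<zz>(P \<circ> X)(a)\<close>, so taking fibres (\<open>slices\<close>) is a bijection between the two; it
  turns inclusion of subobjects into the componentwise order, and it is natural because
  reindexing along \<open>r\<close> replaces \<open>f\<close> by \<open>rf\<close> on both sides (\<open>slices_order_iso\<close>,
  \<open>slices_act\<close>).

  Everything else in an internal suplattice is determined by the orders and the restriction maps: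
  suprema are order-theoretic, and the maps \<open>\<Sigma>\<close> are left adjoints, hence unique. A natural family
  of order isomorphisms therefore carries the whole structure across
  (\<open>internal_suplattice_transport\<close>), in particular the existence of the left adjoints on the
  power-object.

  It remains that \<open>\<zz>L\<close> is an internal suplattice, which holds for every functor \<open>L\<close> to
  complete lattices (\<open>zed_internal_suplattice\<close>). Suprema are componentwise. The
  Beck-Chevalley condition compares two suprema of components of \<open>u\<close>, one indexed by the \<open>f\<close>
  with \<open>rf = sh\<close> and one by the \<open>k\<close> with \<open>qk = h\<close>; the weak universal property of the
  square says that \<open>k \<mapsto> pk\<close> maps the second index set onto the first, so the same elements
  are joined.
\<close>

section \<open>Suprema and adjoints\<close>

lemma sup_le_iff:
  assumes "complete_lattice A" "F \<subseteq> carrier A" "y \<in> carrier A"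
  shows "\<Squnion>\<^bsub>A\<^esub> F \<sqsubseteq>\<^bsub>A\<^esub> y \<longleftrightarrow> (\<forall>x \<in> F. x \<sqsubseteq>\<^bsub>A\<^esub> y)"
proof -
  interpret complete_lattice A by fact
  show ?thesis
    using assms(2,3) by (meson le_trans subsetD sup_closed sup_least sup_upper)
qed

text \<open>Describing a supremum by the elements above it suits adjoints: an adjunction rewrites one
  such equivalence into another.\<close>

lemma sup_eqI:
  assumes "complete_lattice A" "F \<subseteq> carrier A" "s \<in> carrier A"
    and "\<And>y. y \<in> carrier A \<Longrightarrow> s \<sqsubseteq>\<^bsub>A\<^esub> y \<longleftrightarrow> (\<forall>x \<in> F. x \<sqsubseteq>\<^bsub>A\<^esub> y)"
  shows "\<Squnion>\<^bsub>A\<^esub> F = s"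
proof -
  interpret complete_lattice A by fact
  show ?thesis
  proof (rule le_antisym)
    show c: "\<Squnion>\<^bsub>A\<^esub> F \<in> carrier A" by (rule sup_closed[OF assms(2)])
    show "\<Squnion>\<^bsub>A\<^esub> F \<sqsubseteq>\<^bsub>A\<^esub> s"
      using assms(4)[OF assms(3)] sup_le_iff[OF assms(1-3)] le_refl[OF assms(3)] by blast
    show "s \<sqsubseteq>\<^bsub>A\<^esub> \<Squnion>\<^bsub>A\<^esub> F"
      using assms(4)[OF c] sup_le_iff[OF assms(1,2) c] le_refl[OF c] by blast
  qed (rule assms(3))
qed

text \<open>Infima come for free, as suprema of the sets of lower bounds.\<close>

lemma complete_latticeI_sups:
  assumes "partial_order A"
    and sups: "\<And>F. F \<subseteq> carrier A \<Longrightarrow>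
      \<exists>s \<in> carrier A. \<forall>y \<in> carrier A. s \<sqsubseteq>\<^bsub>A\<^esub> y \<longleftrightarrow> (\<forall>x \<in> F. x \<sqsubseteq>\<^bsub>A\<^esub> y)"
  shows "complete_lattice A"
proof -
  interpret partial_order A by fact
  show ?thesis
  proof (rule complete_latticeI)
    fix F assume F: "F \<subseteq> carrier A"
    obtain s where s: "s \<in> carrier A"
      and s_le: "\<And>y. y \<in> carrier A \<Longrightarrow> s \<sqsubseteq>\<^bsub>A\<^esub> y \<longleftrightarrow> (\<forall>x \<in> F. x \<sqsubseteq>\<^bsub>A\<^esub> y)"
      using sups[OF F] by blast
    have "least A s (Upper A F)"
    proof (rule least_UpperI)
      show "x \<sqsubseteq>\<^bsub>A\<^esub> s" if "x \<in> F" for x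
        using that s_le[OF s] le_refl[OF s] by blast
      show "s \<sqsubseteq>\<^bsub>A\<^esub> y" if "y \<in> Upper A F" for y
        using that F s_le[of y] by (auto simp: Upper_def)
    qed (rule F s)+
    then show "\<exists>s. least A s (Upper A F)" by blast
    obtain i where i: "i \<in> carrier A"
      and i_le: "\<And>y. y \<in> carrier A \<Longrightarrow> i \<sqsubseteq>\<^bsub>A\<^esub> y \<longleftrightarrow> (\<forall>x \<in> Lower A F. x \<sqsubseteq>\<^bsub>A\<^esub> y)"
      using sups[of "Lower A F"] by auto
    have "greatest A i (Lower A F)"
    proof (rule greatest_LowerI)
      show "i \<sqsubseteq>\<^bsub>A\<^esub> x" if "x \<in> F" for x
        using that F i_le[of x] by (auto simp: Lower_def)
      show "y \<sqsubseteq>\<^bsub>A\<^esub> i" if "y \<in> Lower A F" for y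
        using that i_le[OF i] le_refl[OF i] by blast
    qed (rule F i)+
    then show "\<exists>i. greatest A i (Lower A F)" by blast
  qed
qed

lemma left_adjointD:
  assumes "left_adjoint A B l u"
  shows "partial_order A" "partial_order B" "l \<in> carrier A \<rightarrow> carrier B" "u \<in> carrier B \<rightarrow> carrier A"
    "\<lbrakk>x \<in> carrier A; y \<in> carrier B\<rbrakk> \<Longrightarrow> l x \<sqsubseteq>\<^bsub>B\<^esub> y \<longleftrightarrow> x \<sqsubseteq>\<^bsub>A\<^esub> u y"
  using assms unfolding left_adjoint_def galois_connection_def galois_connection_axioms_def
    connection_def by simp_all

lemma left_adjointI:
  assumes "partial_order A" "partial_order B" "l \<in> carrier A \<rightarrow> carrier B" "u \<in> carrier B \<rightarrow> carrier A"
    "\<And>x y. \<lbrakk>x \<in> carrier A; y \<in> carrier B\<rbrakk> \<Longrightarrow> l x \<sqsubseteq>\<^bsub>B\<^esub> y \<longleftrightarrow> x \<sqsubseteq>\<^bsub>A\<^esub> u y"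
  shows "left_adjoint A B l u"
  using assms unfolding left_adjoint_def galois_connection_def galois_connection_axioms_def
    connection_def by simp

lemma left_adjoint_unique:
  assumes "left_adjoint A B l u" "left_adjoint A B l' u" "x \<in> carrier A"
  shows "l x = l' x"
proof -
  note l = left_adjointD[OF assms(1)] and l' = left_adjointD[OF assms(2)]
  interpret partial_order B by (rule l(2))
  have "l x \<in> carrier B" "l' x \<in> carrier B" using l(3) l'(3) assms(3) by auto
  then show ?thesis using l(5) l'(5) assms(3) by (metis le_antisym le_refl)
qed

lemma left_adjoint_suplat_map:
  assumes "complete_lattice A" "complete_lattice B" and adj: "left_adjoint A B l u"
  shows "suplat_map A B l"
proof -
  note l = left_adjointD[OF adj]
  interpret A: complete_lattice A by fact
  have "l (\<Squnion>\<^bsub>A\<^esub> F) = \<Squnion>\<^bsub>B\<^esub> (l ` F)" if F: "F \<subseteq> carrier A" for F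
  proof (rule sup_eqI[symmetric, OF assms(2)])
    show "l ` F \<subseteq> carrier B" "l (\<Squnion>\<^bsub>A\<^esub> F) \<in> carrier B" using l(3) F A.sup_closed[OF F] by auto
    fix y assume y: "y \<in> carrier B"
    then have "u y \<in> carrier A" using l(4) by auto
    then show "l (\<Squnion>\<^bsub>A\<^esub> F) \<sqsubseteq>\<^bsub>B\<^esub> y \<longleftrightarrow> (\<forall>x \<in> l ` F. x \<sqsubseteq>\<^bsub>B\<^esub> y)"
      using F y l(5) A.sup_closed[OF F] sup_le_iff[OF assms(1) F] by (simp add: subset_iff)
  qed
  then show ?thesis using l(3) assms(1,2) by (simp add: suplat_map_def sup_pres_def)
qed

lemma suplat_mapD:
  assumes "suplat_map A B \<phi>"
  shows "complete_lattice A" "complete_lattice B" "\<phi> \<in> carrier A \<rightarrow> carrier B"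
    "F \<subseteq> carrier A \<Longrightarrow> \<phi> (\<Squnion>\<^bsub>A\<^esub> F) = \<Squnion>\<^bsub>B\<^esub> (\<phi> ` F)"
  using assms unfolding suplat_map_def sup_pres_def by blast+

lemma suplat_mapI:
  assumes "complete_lattice A" "complete_lattice B" "\<phi> \<in> carrier A \<rightarrow> carrier B"
    "\<And>F. F \<subseteq> carrier A \<Longrightarrow> \<phi> (\<Squnion>\<^bsub>A\<^esub> F) = \<Squnion>\<^bsub>B\<^esub> (\<phi> ` F)"
  shows "suplat_map A B \<phi>"
  using assms unfolding suplat_map_def sup_pres_def by blast

lemma suplat_map_comp:
  assumes \<phi>: "suplat_map A B \<phi>" and \<psi>: "suplat_map B D \<psi>"
  shows "suplat_map A D (\<lambda>x. \<psi> (\<phi> x))"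
proof (rule suplat_mapI)
  show "(\<lambda>x. \<psi> (\<phi> x)) \<in> carrier A \<rightarrow> carrier D"
    using suplat_mapD(3)[OF \<phi>] suplat_mapD(3)[OF \<psi>] by auto
  fix F assume F: "F \<subseteq> carrier A"
  then have "\<phi> ` F \<subseteq> carrier B" using suplat_mapD(3)[OF \<phi>] by auto
  then show "\<psi> (\<phi> (\<Squnion>\<^bsub>A\<^esub> F)) = \<Squnion>\<^bsub>D\<^esub> ((\<lambda>x. \<psi> (\<phi> x)) ` F)"
    by (simp add: suplat_mapD(4)[OF \<phi> F] suplat_mapD(4)[OF \<psi>] image_image)
qed (rule suplat_mapD[OF \<phi>] suplat_mapD[OF \<psi>])+

lemma suplat_map_cong:
  assumes \<phi>: "suplat_map A B \<phi>" and eq: "\<And>x. x \<in> carrier A \<Longrightarrow> \<phi>' x = \<phi> x"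
  shows "suplat_map A B \<phi>'"
proof (rule suplat_mapI)
  show "\<phi>' \<in> carrier A \<rightarrow> carrier B"
    by (rule funcsetI) (simp add: eq funcset_mem[OF suplat_mapD(3)[OF \<phi>]])
  fix F assume F: "F \<subseteq> carrier A"
  interpret complete_lattice A by (rule suplat_mapD[OF \<phi>])
  have "\<phi>' ` F = \<phi> ` F" using F by (intro image_cong eq) blast+
  then show "\<phi>' (\<Squnion>\<^bsub>A\<^esub> F) = \<Squnion>\<^bsub>B\<^esub> (\<phi>' ` F)"
    using suplat_mapD(4)[OF \<phi> F] eq[OF sup_closed[OF F]] by metis
qed (fact suplat_mapD(1,2)[OF \<phi>])+


section \<open>The internal suplattice \<open>\<zz>L\<close>\<close>

text \<open>The generality matters: in the case \<open>L = P \<circ> X\<close> the restriction maps are direct images,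
  which preserve unions but not always intersections, and then \<open>L\<close> itself lacks maps
  \<open>\<Sigma>\<close>.\<close>

locale small_suplat_functor = small_category C + suplat_functor C L
  for C :: "('o, 'm) cat" and L :: "('o, 'm, 'l, 'z) slfun_scheme"
begin

abbreviation "Z \<equiv> zed_lat C L"

lemma intoD: "f \<in> into C a \<Longrightarrow> f \<in> arr C \<and> tgt C f = a \<and> src C f \<in> obj C"
  by (simp add: into_def src_obj)

lemma cmp_into: "\<lbrakk>f \<in> into C a; g \<in> into C (src C f)\<rbrakk> \<Longrightarrow> cmp C f g \<in> into C a"
  by (simp add: into_def cmp_arr tgt_cmp)

lemma zed_le: "u \<sqsubseteq>\<^bsub>Z a\<^esub> v \<longleftrightarrow> (\<forall>f \<in> into C a. u f \<sqsubseteq>\<^bsub>lat L (src C f)\<^esub> v f)"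
  by (simp add: zed_lat_def)

lemma zed_closed: "\<lbrakk>u \<in> carrier (Z a); f \<in> into C a\<rbrakk> \<Longrightarrow> u f \<in> carrier (lat L (src C f))"
  by (auto simp: zed_lat_def)

lemma zed_lax:
  "\<lbrakk>u \<in> carrier (Z a); f \<in> into C a; g \<in> into C (src C f)\<rbrakk>
    \<Longrightarrow> res L g (u f) \<sqsubseteq>\<^bsub>lat L (src C g)\<^esub> u (cmp C f g)"
  by (simp add: zed_lat_def)

lemma zed_eqI:
  "\<lbrakk>u \<in> carrier (Z a); v \<in> carrier (Z a); \<And>f. f \<in> into C a \<Longrightarrow> u f = v f\<rbrakk> \<Longrightarrow> u = v"
  unfolding zed_lat_def by (auto intro: PiE_ext)

lemma zed_partial_order: "partial_order (Z a)"
proof -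
  have po: "partial_order (lat L (src C f))" if "f \<in> into C a" for f
    using lat_complete[of "src C f"] intoD[OF that] by (simp add: complete_lattice_def)
  have refl: "u \<sqsubseteq>\<^bsub>Z a\<^esub> u" if "u \<in> carrier (Z a)" for u
    unfolding zed_le
  proof
    fix f assume f: "f \<in> into C a"
    interpret partial_order "lat L (src C f)" by (rule po[OF f])
    show "u f \<sqsubseteq>\<^bsub>lat L (src C f)\<^esub> u f" by (rule le_refl[OF zed_closed[OF that f]])
  qed
  have trans: "u \<sqsubseteq>\<^bsub>Z a\<^esub> w"
    if "u \<sqsubseteq>\<^bsub>Z a\<^esub> v" "v \<sqsubseteq>\<^bsub>Z a\<^esub> w"
      and c: "u \<in> carrier (Z a)" "v \<in> carrier (Z a)" "w \<in> carrier (Z a)" for u v w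
    unfolding zed_le
  proof
    fix f assume f: "f \<in> into C a"
    interpret partial_order "lat L (src C f)" by (rule po[OF f])
    have "u f \<sqsubseteq>\<^bsub>lat L (src C f)\<^esub> v f" "v f \<sqsubseteq>\<^bsub>lat L (src C f)\<^esub> w f"
      using that(1,2) f by (simp_all add: zed_le)
    then show "u f \<sqsubseteq>\<^bsub>lat L (src C f)\<^esub> w f" by (rule le_trans[OF _ _ c[THEN zed_closed, OF f]])
  qed
  have antisym: "u = v"
    if "u \<sqsubseteq>\<^bsub>Z a\<^esub> v" "v \<sqsubseteq>\<^bsub>Z a\<^esub> u" and c: "u \<in> carrier (Z a)" "v \<in> carrier (Z a)" for u v
  proof (rule zed_eqI[OF c])
    fix f assume f: "f \<in> into C a"
    interpret partial_order "lat L (src C f)" by (rule po[OF f])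
    have "u f \<sqsubseteq>\<^bsub>lat L (src C f)\<^esub> v f" "v f \<sqsubseteq>\<^bsub>lat L (src C f)\<^esub> u f"
      using that(1,2) f by (simp_all add: zed_le)
    then show "u f = v f" by (rule le_antisym[OF _ _ c[THEN zed_closed, OF f]])
  qed
  have eq: "eq (Z a) = (=)" by (simp add: zed_lat_def)
  show ?thesis
    by unfold_locales (simp_all add: eq refl, (blast intro: antisym trans)+)
qed

text \<open>Pointwise suprema, as well as the maps \<open>\<Sigma>\<close>, are families of suprema \<open>g \<mapsto> \<Or> S g\<close>.
  Such a family satisfies the inequality \<open>L k (\<Or> S g) \<le> \<Or> S (gk)\<close> as soon as each element of
  \<open>S g\<close>, restricted along \<open>k\<close>, lies below an element of \<open>S (gk)\<close>: this is where
  restriction has to preserve suprema.\<close>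

lemma zed_sup_family:
  assumes S: "\<And>g. g \<in> into C a \<Longrightarrow> S g \<subseteq> carrier (lat L (src C g))"
    and lax: "\<And>g k x. \<lbrakk>g \<in> into C a; k \<in> into C (src C g); x \<in> S g\<rbrakk>
      \<Longrightarrow> \<exists>y \<in> S (cmp C g k). res L k x \<sqsubseteq>\<^bsub>lat L (src C k)\<^esub> y"
  shows "(\<lambda>g \<in> into C a. \<Squnion>\<^bsub>lat L (src C g)\<^esub> (S g)) \<in> carrier (Z a)"
proof -
  have closed: "\<Squnion>\<^bsub>lat L (src C g)\<^esub> (S g) \<in> carrier (lat L (src C g))" if "g \<in> into C a" for g
  proof -
    interpret complete_lattice "lat L (src C g)" using that by (simp add: lat_complete intoD)
    show ?thesis using S that by simp
  qed
  have "res L k (\<Squnion>\<^bsub>lat L (src C g)\<^esub> (S g)) \<sqsubseteq>\<^bsub>lat L (src C k)\<^esub>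
      \<Squnion>\<^bsub>lat L (src C (cmp C g k))\<^esub> (S (cmp C g k))"
    if g: "g \<in> into C a" and k: "k \<in> into C (src C g)" for g k
  proof -
    have gk: "cmp C g k \<in> into C a" "src C (cmp C g k) = src C k"
      using g k cmp_into by (auto simp: into_def src_cmp)
    have c: "complete_lattice (lat L (src C k))" using k by (simp add: lat_complete intoD)
    interpret complete_lattice "lat L (src C k)" by (rule c)
    have m: "suplat_map (lat L (src C g)) (lat L (src C k)) (res L k)"
      using res_map[of k] k by (simp add: into_def)
    have Sk: "res L k ` S g \<subseteq> carrier (lat L (src C k))" using m S[OF g] by (auto simp: suplat_map_def)
    have Sgk: "S (cmp C g k) \<subseteq> carrier (lat L (src C k))" using S[OF gk(1)] gk(2) by simp
    have "\<Squnion>\<^bsub>lat L (src C k)\<^esub> (res L k ` S g) \<sqsubseteq>\<^bsub>lat L (src C k)\<^esub>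
        \<Squnion>\<^bsub>lat L (src C k)\<^esub> (S (cmp C g k))"
    proof (rule sup_least[OF Sk sup_closed[OF Sgk]])
      fix z assume "z \<in> res L k ` S g"
      then obtain y where y: "y \<in> S (cmp C g k)" "z \<sqsubseteq>\<^bsub>lat L (src C k)\<^esub> y" and "z \<in> carrier (lat L (src C k))"
        using lax[OF g k] Sk by blast
      then show "z \<sqsubseteq>\<^bsub>lat L (src C k)\<^esub> \<Squnion>\<^bsub>lat L (src C k)\<^esub> (S (cmp C g k))"
        using le_trans[OF y(2) sup_upper[OF Sgk y(1)]] Sgk by auto
    qed
    then show ?thesis using m S[OF g] gk(2) by (simp add: suplat_map_def sup_pres_def)
  qed
  then show ?thesis
    using closed cmp_into by (auto simp: zed_lat_def)
qed

definition zed_sup :: "'o \<Rightarrow> ('m \<Rightarrow> 'l) set \<Rightarrow> 'm \<Rightarrow> 'l" where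
  "zed_sup a F = (\<lambda>f \<in> into C a. \<Squnion>\<^bsub>lat L (src C f)\<^esub> ((\<lambda>u. u f) ` F))"

lemma zed_sup_closed: "F \<subseteq> carrier (Z a) \<Longrightarrow> zed_sup a F \<in> carrier (Z a)"
  unfolding zed_sup_def
proof (rule zed_sup_family)
  assume F: "F \<subseteq> carrier (Z a)"
  fix g assume g: "g \<in> into C a"
  show "(\<lambda>u. u g) ` F \<subseteq> carrier (lat L (src C g))"
    using zed_closed[OF subsetD[OF F] g] by (rule image_subsetI)
  fix k x assume k: "k \<in> into C (src C g)" and "x \<in> (\<lambda>u. u g) ` F"
  then obtain u where "u \<in> F" "x = u g" by blast
  then show "\<exists>y \<in> (\<lambda>u. u (cmp C g k)) ` F. res L k x \<sqsubseteq>\<^bsub>lat L (src C k)\<^esub> y"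
    using zed_lax[OF subsetD[OF F] g k] by blast
qed

lemma zed_sup_le_iff:
  assumes F: "F \<subseteq> carrier (Z a)" and v: "v \<in> carrier (Z a)"
  shows "zed_sup a F \<sqsubseteq>\<^bsub>Z a\<^esub> v \<longleftrightarrow> (\<forall>u \<in> F. u \<sqsubseteq>\<^bsub>Z a\<^esub> v)"
proof -
  have "\<Squnion>\<^bsub>lat L (src C f)\<^esub> ((\<lambda>u. u f) ` F) \<sqsubseteq>\<^bsub>lat L (src C f)\<^esub> v f \<longleftrightarrow>
      (\<forall>u \<in> F. u f \<sqsubseteq>\<^bsub>lat L (src C f)\<^esub> v f)" if f: "f \<in> into C a" for f
  proof -
    have "(\<lambda>u. u f) ` F \<subseteq> carrier (lat L (src C f))"
      using zed_closed[OF subsetD[OF F] f] by (rule image_subsetI)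
    then show ?thesis
      using sup_le_iff[OF lat_complete _ zed_closed[OF v f]] intoD[OF f] by simp
  qed
  then show ?thesis by (auto simp: zed_le zed_sup_def)
qed

lemma zed_complete: "complete_lattice (Z a)"
proof (rule complete_latticeI_sups[OF zed_partial_order])
  fix F assume "F \<subseteq> carrier (Z a)"
  then show "\<exists>s \<in> carrier (Z a). \<forall>v \<in> carrier (Z a). s \<sqsubseteq>\<^bsub>Z a\<^esub> v \<longleftrightarrow> (\<forall>u \<in> F. u \<sqsubseteq>\<^bsub>Z a\<^esub> v)"
    using zed_sup_le_iff by (intro bexI[OF _ zed_sup_closed]) blast+
qed

lemma zed_sup_eq: "F \<subseteq> carrier (Z a) \<Longrightarrow> \<Squnion>\<^bsub>Z a\<^esub> F = zed_sup a F"
  by (rule sup_eqI[OF zed_complete _ zed_sup_closed zed_sup_le_iff])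

abbreviation "zres \<equiv> res (zed C L)"
abbreviation "zsig \<equiv> sig (zed C L)"

lemma zres_apply: "h \<in> into C (src C r) \<Longrightarrow> zres r u h = u (cmp C r h)"
  by (simp add: zed_def)

lemma arr_into: "r \<in> arr C \<Longrightarrow> r \<in> into C (tgt C r)"
  by (simp add: into_def)

lemma zres_closed:
  assumes r: "r \<in> arr C" and u: "u \<in> carrier (Z (tgt C r))"
  shows "zres r u \<in> carrier (Z (src C r))"
proof -
  have "u (cmp C r h) \<in> carrier (lat L (src C h))" if h: "h \<in> into C (src C r)" for h
    using zed_closed[OF u cmp_into[OF arr_into[OF r] h]] r h by (simp add: into_def src_cmp)
  moreover have "res L g (u (cmp C r h)) \<sqsubseteq>\<^bsub>lat L (src C g)\<^esub> u (cmp C r (cmp C h g))"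
    if h: "h \<in> into C (src C r)" and g: "g \<in> into C (src C h)" for h g
    using zed_lax[OF u cmp_into[OF arr_into[OF r] h], of g] r h g
    by (simp add: into_def src_cmp cmp_assoc)
  ultimately show ?thesis
    using cmp_into by (simp add: zed_lat_def zed_def)
qed

lemma zres_suplat_map:
  assumes r: "r \<in> arr C"
  shows "suplat_map (Z (tgt C r)) (Z (src C r)) (zres r)"
proof -
  have "zres r (\<Squnion>\<^bsub>Z (tgt C r)\<^esub> F) = \<Squnion>\<^bsub>Z (src C r)\<^esub> (zres r ` F)" if F: "F \<subseteq> carrier (Z (tgt C r))" for F
  proof -
    have F': "zres r ` F \<subseteq> carrier (Z (src C r))" using F zres_closed[OF r] by blast
    show ?thesis
      unfolding zed_sup_eq[OF F] zed_sup_eq[OF F']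
    proof (rule zed_eqI)
      show "zres r (zed_sup (tgt C r) F) \<in> carrier (Z (src C r))"
        by (rule zres_closed[OF r zed_sup_closed[OF F]])
      show "zed_sup (src C r) (zres r ` F) \<in> carrier (Z (src C r))"
        by (rule zed_sup_closed[OF F'])
      fix h assume h: "h \<in> into C (src C r)"
      have "cmp C r h \<in> into C (tgt C r)" "src C (cmp C r h) = src C h"
        using cmp_into[OF arr_into[OF r] h] r h by (auto simp: into_def src_cmp)
      then show "zres r (zed_sup (tgt C r) F) h = zed_sup (src C r) (zres r ` F) h"
        using h by (simp add: zres_apply zed_sup_def image_image)
    qed
  qed
  then show ?thesis
    using zres_closed[OF r] zed_complete by (simp add: suplat_map_def sup_pres_def)
qed

lemma zsig_apply:
  "g \<in> into C (tgt C r) \<Longrightarrow>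
    zsig r u g = \<Squnion>\<^bsub>lat L (src C g)\<^esub> {u f | f. f \<in> into C (src C r) \<and> cmp C r f = g}"
  by (simp add: zed_def)

lemma zsig_family:
  assumes r: "r \<in> arr C" and u: "u \<in> carrier (Z (src C r))"
  shows "{u f | f. f \<in> into C (src C r) \<and> cmp C r f = g} \<subseteq> carrier (lat L (src C g))"
  using zed_closed[OF u] r by (auto simp: into_def src_cmp)

lemma zsig_closed:
  assumes r: "r \<in> arr C" and u: "u \<in> carrier (Z (src C r))"
  shows "zsig r u \<in> carrier (Z (tgt C r))"
proof -
  have "(\<lambda>g \<in> into C (tgt C r). \<Squnion>\<^bsub>lat L (src C g)\<^esub> {u f | f. f \<in> into C (src C r) \<and> cmp C r f = g})
      \<in> carrier (Z (tgt C r))"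
  proof (rule zed_sup_family[OF zsig_family[OF r u]])
    fix g k x
    assume "g \<in> into C (tgt C r)" and k: "k \<in> into C (src C g)"
      and "x \<in> {u f | f. f \<in> into C (src C r) \<and> cmp C r f = g}"
    then obtain f where f: "f \<in> into C (src C r)" "cmp C r f = g" "x = u f" by blast
    have k': "k \<in> into C (src C f)" using k f r by (auto simp: into_def src_cmp)
    have "cmp C r (cmp C f k) = cmp C g k"
      using f k' r by (auto simp: into_def cmp_assoc)
    then show "\<exists>y \<in> {u f | f. f \<in> into C (src C r) \<and> cmp C r f = cmp C g k}. res L k x \<sqsubseteq>\<^bsub>lat L (src C k)\<^esub> y"
      using zed_lax[OF u f(1) k'] cmp_into[OF f(1) k'] f(3) by blast
  qed
  then show ?thesis by (simp add: zed_def)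
qed

text \<open>Both sides of the adjunction say that \<open>u f \<le> v (rf)\<close> for all \<open>f\<close> into the source
  of \<open>r\<close>.\<close>

lemma zsig_adjoint:
  assumes r: "r \<in> arr C"
  shows "left_adjoint (Z (src C r)) (Z (tgt C r)) (zsig r) (zres r)"
proof (rule left_adjointI)
  fix u v assume u: "u \<in> carrier (Z (src C r))" and v: "v \<in> carrier (Z (tgt C r))"
  have 1: "zsig r u g \<sqsubseteq>\<^bsub>lat L (src C g)\<^esub> v g \<longleftrightarrow>
      (\<forall>f \<in> into C (src C r). cmp C r f = g \<longrightarrow> u f \<sqsubseteq>\<^bsub>lat L (src C g)\<^esub> v g)"
    if g: "g \<in> into C (tgt C r)" for g
    unfolding zsig_apply[OF g]
    using lat_complete intoD[OF g] zed_closed[OF v g]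
    by (subst sup_le_iff[OF _ zsig_family[OF r u]]) auto
  have 2: "cmp C r f \<in> into C (tgt C r)" "src C (cmp C r f) = src C f" if "f \<in> into C (src C r)" for f
    using cmp_into[OF arr_into[OF r] that] r that by (auto simp: into_def src_cmp)
  show "zsig r u \<sqsubseteq>\<^bsub>Z (tgt C r)\<^esub> v \<longleftrightarrow> u \<sqsubseteq>\<^bsub>Z (src C r)\<^esub> zres r v"
    unfolding zed_le using 1 2 by (fastforce simp: zres_apply)
qed (use zed_partial_order zsig_closed[OF r] zres_closed[OF r] in auto)

lemma zed_beck_chevalley:
  assumes wp: "weak_pullback C r s p q" and u: "u \<in> carrier (Z (src C r))"
  shows "zres s (zsig r u) = zsig q (zres p u)"
proof (rule zed_eqI)
  have arrs: "r \<in> arr C" "s \<in> arr C" "p \<in> arr C" "q \<in> arr C" and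
    t: "tgt C r = tgt C s" "src C p = src C q" "tgt C p = src C r" "tgt C q = src C s"
      "cmp C r p = cmp C s q"
    using wp by (auto simp: weak_pullback_def)
  show "zres s (zsig r u) \<in> carrier (Z (src C s))"
    using zres_closed[OF arrs(2)] zsig_closed[OF arrs(1) u] t by simp
  show "zsig q (zres p u) \<in> carrier (Z (src C s))"
    using zsig_closed[OF arrs(4)] zres_closed[OF arrs(3)] u t by simp
  fix h assume h: "h \<in> into C (src C s)"
  have sh: "cmp C s h \<in> into C (tgt C r)" "src C (cmp C s h) = src C h"
    using cmp_into[OF arr_into[OF arrs(2)] h] arrs h t by (auto simp: into_def src_cmp)
  \<comment> \<open>The two suprema are taken over the same set of elements: a pair \<open>(f, h)\<close> with \<open>rf = sh\<close>
    factors through the weak pullback as \<open>f = pk\<close>, \<open>h = qk\<close>; several \<open>k\<close> may give the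
    same \<open>f\<close>, which a supremum does not notice.\<close>
  have "{u f | f. f \<in> into C (src C r) \<and> cmp C r f = cmp C s h} =
      {zres p u k | k. k \<in> into C (src C q) \<and> cmp C q k = h}" (is "?A = ?B")
  proof
    show "?A \<subseteq> ?B"
    proof clarify
      fix f assume f: "f \<in> into C (src C r)" and eq: "cmp C r f = cmp C s h"
      have "src C f = src C h"
        using f eq sh(2) arrs by (metis (mono_tags, lifting) into_def mem_Collect_eq src_cmp)
      then obtain k where k: "k \<in> arr C" "tgt C k = src C p" "cmp C p k = f" "cmp C q k = h"
        using wp f h eq unfolding weak_pullback_def into_def by blast
      then have "zres p u k = u f" by (simp add: zres_apply into_def)
      then show "\<exists>k. u f = zres p u k \<and> k \<in> into C (src C q) \<and> cmp C q k = h"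
        using k t by (intro exI[of _ k]) (simp add: into_def)
    qed
    show "?B \<subseteq> ?A"
    proof clarify
      fix k assume k: "k \<in> into C (src C q)" and h: "h = cmp C q k"
      have "cmp C r (cmp C p k) = cmp C s (cmp C q k)"
        using k t arrs cmp_assoc[of r p k] cmp_assoc[of s q k] by (simp add: into_def)
      moreover have "cmp C p k \<in> into C (src C r)" using k t arrs by (simp add: into_def cmp_arr tgt_cmp)
      moreover have "zres p u k = u (cmp C p k)" using k t by (simp add: zres_apply)
      ultimately show "\<exists>f. zres p u k = u f \<and> f \<in> into C (src C r) \<and> cmp C r f = cmp C s (cmp C q k)"
        by blast
    qed
  qed
  then show "zres s (zsig r u) h = zsig q (zres p u) h"
    using h sh t by (simp add: zres_apply zsig_apply)
qed

theorem zed_internal_suplattice: "internal_suplattice C (zed C L)"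
proof -
  have lat: "lat (zed C L) = Z" by (simp add: zed_def)
  show ?thesis
  proof (intro internal_suplattice.intro suplat_functor.intro internal_suplattice_axioms.intro
      small_category_axioms; unfold lat)
    fix a u assume a: "a \<in> obj C" and u: "u \<in> carrier (Z a)"
    have "zres (idn C a) u \<in> carrier (Z a)"
      using zres_closed[of "idn C a" u] a u by (simp add: idn_arr src_idn tgt_idn)
    then show "zres (idn C a) u = u"
    proof (rule zed_eqI[OF _ u])
      fix f assume f: "f \<in> into C a"
      then have "cmp C (idn C a) f = f" using idn_left by (auto simp: into_def)
      then show "zres (idn C a) u f = u f" using a f by (simp add: zres_apply src_idn)
    qed
  next
    fix f g u
    assume fg: "f \<in> arr C" "g \<in> arr C" "tgt C g = src C f" and u: "u \<in> carrier (Z (tgt C f))"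
    show "zres (cmp C f g) u = zres g (zres f u)"
    proof (rule zed_eqI)
      show "zres (cmp C f g) u \<in> carrier (Z (src C g))"
        using zres_closed[of "cmp C f g" u] fg u by (simp add: cmp_arr src_cmp tgt_cmp)
      show "zres g (zres f u) \<in> carrier (Z (src C g))"
        using zres_closed[of g] zres_closed[of f] fg u by simp
      fix h assume h: "h \<in> into C (src C g)"
      then have "cmp C g h \<in> into C (src C f)" using fg by (simp add: into_def cmp_arr tgt_cmp)
      then show "zres (cmp C f g) u h = zres g (zres f u) h"
        using fg h by (simp add: zres_apply src_cmp) (simp add: into_def cmp_assoc)
    qed
  qed (blast intro: zed_complete zres_suplat_map zsig_adjoint zed_beck_chevalley)+
qed

end


section \<open>Transport of internal suplattices along order isomorphisms\<close>

definition order_iso :: "'k gorder \<Rightarrow> 'l gorder \<Rightarrow> ('k \<Rightarrow> 'l) \<Rightarrow> ('l \<Rightarrow> 'k) \<Rightarrow> bool" where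
  "order_iso A B \<phi> \<psi> \<longleftrightarrow>
     \<phi> \<in> carrier A \<rightarrow> carrier B \<and> \<psi> \<in> carrier B \<rightarrow> carrier A \<and>
     (\<forall>x \<in> carrier A. \<psi> (\<phi> x) = x) \<and> (\<forall>y \<in> carrier B. \<phi> (\<psi> y) = y) \<and>
     (\<forall>x \<in> carrier A. \<forall>x' \<in> carrier A. \<phi> x \<sqsubseteq>\<^bsub>B\<^esub> \<phi> x' \<longleftrightarrow> x \<sqsubseteq>\<^bsub>A\<^esub> x')"

lemma order_isoD:
  assumes "order_iso A B \<phi> \<psi>"
  shows "x \<in> carrier A \<Longrightarrow> \<phi> x \<in> carrier B" "y \<in> carrier B \<Longrightarrow> \<psi> y \<in> carrier A"
    "x \<in> carrier A \<Longrightarrow> \<psi> (\<phi> x) = x" "y \<in> carrier B \<Longrightarrow> \<phi> (\<psi> y) = y"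
    "\<lbrakk>x \<in> carrier A; x' \<in> carrier A\<rbrakk> \<Longrightarrow> \<phi> x \<sqsubseteq>\<^bsub>B\<^esub> \<phi> x' \<longleftrightarrow> x \<sqsubseteq>\<^bsub>A\<^esub> x'"
  using assms by (auto simp: order_iso_def)

lemma order_iso_sym: "order_iso A B \<phi> \<psi> \<Longrightarrow> order_iso B A \<psi> \<phi>"
  by (simp add: order_iso_def Pi_iff) metis

lemma order_iso_left_adjoint:
  assumes "partial_order A" "partial_order B" and iso: "order_iso A B \<phi> \<psi>"
  shows "left_adjoint A B \<phi> \<psi>"
proof (rule left_adjointI[OF assms(1,2)])
  note i = order_isoD[OF iso]
  show "\<phi> \<in> carrier A \<rightarrow> carrier B" "\<psi> \<in> carrier B \<rightarrow> carrier A" using i by auto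
  fix x y assume "x \<in> carrier A" "y \<in> carrier B"
  then show "\<phi> x \<sqsubseteq>\<^bsub>B\<^esub> y \<longleftrightarrow> x \<sqsubseteq>\<^bsub>A\<^esub> \<psi> y" using i by metis
qed

lemma left_adjoint_comp:
  assumes "left_adjoint A B l u" "left_adjoint B D l' u'"
  shows "left_adjoint A D (\<lambda>x. l' (l x)) (\<lambda>y. u (u' y))"
proof -
  note 1 = left_adjointD[OF assms(1)] and 2 = left_adjointD[OF assms(2)]
  show ?thesis by (rule left_adjointI) (use 1 2 in \<open>auto simp: Pi_iff\<close>)
qed

lemma left_adjoint_cong:
  assumes "left_adjoint A B l u" and eq: "\<And>y. y \<in> carrier B \<Longrightarrow> u' y = u y"
  shows "left_adjoint A B l u'"
proof -
  note 1 = left_adjointD[OF assms(1)]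
  show ?thesis by (rule left_adjointI) (use 1 eq in \<open>auto simp: Pi_iff\<close>)
qed

text \<open>The order on \<open>A\<close> is the one pulled back from \<open>B\<close>. It is a partial order because
  \<open>\<phi>\<close> is injective, and suprema are computed in \<open>B\<close> and brought back by \<open>\<psi>\<close>.\<close>

lemma order_iso_complete:
  assumes iso: "order_iso A B \<phi> \<psi>" and B: "complete_lattice B" and eq: "eq A = (=)"
  shows "complete_lattice A"
proof -
  note i = order_isoD[OF iso]
  interpret B: complete_lattice B by fact
  have anti: "x = y" if "x \<sqsubseteq>\<^bsub>A\<^esub> y" "y \<sqsubseteq>\<^bsub>A\<^esub> x" "x \<in> carrier A" "y \<in> carrier A" for x y
  proof -
    have "\<phi> x = \<phi> y" using that i by (intro B.le_antisym) auto
    then show ?thesis using i(3) that by metis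
  qed
  have trans: "x \<sqsubseteq>\<^bsub>A\<^esub> z"
    if "x \<sqsubseteq>\<^bsub>A\<^esub> y" "y \<sqsubseteq>\<^bsub>A\<^esub> z" "x \<in> carrier A" "y \<in> carrier A" "z \<in> carrier A" for x y z
    using B.le_trans[of "\<phi> x" "\<phi> y" "\<phi> z"] i that by simp
  have refl: "x \<sqsubseteq>\<^bsub>A\<^esub> x" if "x \<in> carrier A" for x
    using B.le_refl[OF i(1)[OF that]] i(5)[OF that that] by blast
  have po: "partial_order A"
    by unfold_locales (auto simp: eq intro: refl anti trans)
  show ?thesis
  proof (rule complete_latticeI_sups[OF po])
    fix F assume F: "F \<subseteq> carrier A"
    then have F': "\<phi> ` F \<subseteq> carrier B" using i by auto
    let ?s = "\<psi> (\<Squnion>\<^bsub>B\<^esub> (\<phi> ` F))"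
    have s: "?s \<in> carrier A" "\<phi> ?s = \<Squnion>\<^bsub>B\<^esub> (\<phi> ` F)" using i B.sup_closed[OF F'] by auto
    have "?s \<sqsubseteq>\<^bsub>A\<^esub> y \<longleftrightarrow> (\<forall>x \<in> F. x \<sqsubseteq>\<^bsub>A\<^esub> y)" if y: "y \<in> carrier A" for y
    proof -
      have "?s \<sqsubseteq>\<^bsub>A\<^esub> y \<longleftrightarrow> \<phi> ?s \<sqsubseteq>\<^bsub>B\<^esub> \<phi> y" using i(5)[OF s(1) y] by (rule sym)
      also have "\<dots> \<longleftrightarrow> (\<forall>x \<in> F. \<phi> x \<sqsubseteq>\<^bsub>B\<^esub> \<phi> y)"
        using sup_le_iff[OF B F' i(1)[OF y]] s(2) by simp
      also have "\<dots> \<longleftrightarrow> (\<forall>x \<in> F. x \<sqsubseteq>\<^bsub>A\<^esub> y)" using i(5) F y by blast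
      finally show ?thesis .
    qed
    then show "\<exists>s \<in> carrier A. \<forall>y \<in> carrier A. s \<sqsubseteq>\<^bsub>A\<^esub> y \<longleftrightarrow> (\<forall>x \<in> F. x \<sqsubseteq>\<^bsub>A\<^esub> y)"
      using s by blast
  qed
qed

text \<open>On \<open>K\<close> only the order and the restriction maps are compared with those of \<open>L\<close>.
  The left adjoint \<open>\<psi> \<circ> \<Sigma> \<circ> \<phi>\<close> of restriction then exists, so the assumption on
  \<open>sig K\<close>, which is conditional on the existence of some left adjoint, makes \<open>sig K\<close> one too; by
  uniqueness of adjoints the two agree, and \<open>\<phi>\<close> and \<open>\<psi>\<close> commute with \<open>\<Sigma>\<close>. All
  equations of \<open>K\<close> are then checked after applying the injective map \<open>\<phi>\<close>.\<close>

theorem internal_suplattice_transport: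
  fixes C :: "('o, 'm) cat" and K :: "('o, 'm, 'k) isuplat" and L :: "('o, 'm, 'l) isuplat"
  assumes L: "internal_suplattice C L"
    and iso: "\<And>a. a \<in> obj C \<Longrightarrow> order_iso (lat K a) (lat L a) (\<phi> a) (\<psi> a)"
    and eq: "\<And>a. a \<in> obj C \<Longrightarrow> eq (lat K a) = (=)"
    and closed: "\<And>f u. \<lbrakk>f \<in> arr C; u \<in> carrier (lat K (tgt C f))\<rbrakk> \<Longrightarrow> res K f u \<in> carrier (lat K (src C f))"
    and nat: "\<And>f u. \<lbrakk>f \<in> arr C; u \<in> carrier (lat K (tgt C f))\<rbrakk> \<Longrightarrow>
      \<phi> (src C f) (res K f u) = res L f (\<phi> (tgt C f) u)"
    and adj: "\<And>f l. \<lbrakk>f \<in> arr C; left_adjoint (lat K (src C f)) (lat K (tgt C f)) l (res K f)\<rbrakk> \<Longrightarrow>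
      left_adjoint (lat K (src C f)) (lat K (tgt C f)) (sig K f) (res K f)"
  shows "internal_suplattice C K \<and> isuplat_isomorphic C K L"
proof -
  interpret L: internal_suplattice C L by fact
  note i = order_isoD[OF iso]
  have compl: "complete_lattice (lat K a)" if "a \<in> obj C" for a
    using order_iso_complete[OF iso L.lat_complete eq] that by blast
  have po: "partial_order (lat K a)" "partial_order (lat L a)" if "a \<in> obj C" for a
    using compl[OF that] L.lat_complete[OF that] by (simp_all add: complete_lattice_def)
  have adj\<phi>: "left_adjoint (lat K a) (lat L a) (\<phi> a) (\<psi> a)"
    and adj\<psi>: "left_adjoint (lat L a) (lat K a) (\<psi> a) (\<phi> a)" if "a \<in> obj C" for a
    using order_iso_left_adjoint po that iso order_iso_sym by blast+
  have map\<phi>: "suplat_map (lat K a) (lat L a) (\<phi> a)"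
    and map\<psi>: "suplat_map (lat L a) (lat K a) (\<psi> a)" if "a \<in> obj C" for a
    using left_adjoint_suplat_map compl L.lat_complete adj\<phi> adj\<psi> that by blast+
  have resK: "res K f u = \<psi> (src C f) (res L f (\<phi> (tgt C f) u))"
    if "f \<in> arr C" "u \<in> carrier (lat K (tgt C f))" for f u
    using nat closed i(3) L.src_obj that by metis
  let ?l = "\<lambda>f u. \<psi> (tgt C f) (sig L f (\<phi> (src C f) u))"
  have l: "left_adjoint (lat K (src C f)) (lat K (tgt C f)) (?l f) (res K f)" if f: "f \<in> arr C" for f
    using left_adjoint_comp[OF left_adjoint_comp[OF adj\<phi>[OF L.src_obj[OF f]] L.sig_adjoint[OF f]]
        adj\<psi>[OF L.tgt_obj[OF f]]]
    by (rule left_adjoint_cong) (rule resK[OF f])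
  note sig = adj[OF _ l]
  have sigL_closed: "sig L f v \<in> carrier (lat L (tgt C f))" if "f \<in> arr C" "v \<in> carrier (lat L (src C f))" for f v
    using left_adjointD(3)[OF L.sig_adjoint] that by blast
  have resL_closed: "res L f v \<in> carrier (lat L (src C f))" if "f \<in> arr C" "v \<in> carrier (lat L (tgt C f))" for f v
    using left_adjointD(4)[OF L.sig_adjoint] that by blast
  have sigK: "sig K f u = ?l f u" if "f \<in> arr C" "u \<in> carrier (lat K (src C f))" for f u
    using left_adjoint_unique[OF sig l] that by blast
  have sigK_closed: "sig K f u \<in> carrier (lat K (tgt C f))" if "f \<in> arr C" "u \<in> carrier (lat K (src C f))" for f u
    using left_adjointD(3)[OF sig] that by blast
  have nat_sig: "\<phi> (tgt C f) (sig K f u) = sig L f (\<phi> (src C f) u)"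
    if f: "f \<in> arr C" and u: "u \<in> carrier (lat K (src C f))" for f u
    using sigK[OF f u] i(4)[OF L.tgt_obj[OF f]] sigL_closed[OF f i(1)[OF L.src_obj[OF f] u]] by simp
  have inj: "u = v" if "a \<in> obj C" "u \<in> carrier (lat K a)" "v \<in> carrier (lat K a)" "\<phi> a u = \<phi> a v" for a u v
    using i(3)[OF that(1)] that(2-4) by metis
  have "internal_suplattice C K"
  proof (intro internal_suplattice.intro suplat_functor.intro internal_suplattice_axioms.intro
      L.small_category_axioms)
    fix a assume "a \<in> obj C" then show "complete_lattice (lat K a)" by (rule compl)
  next
    fix f assume f: "f \<in> arr C"
    note o = L.src_obj[OF f] L.tgt_obj[OF f]
    show "suplat_map (lat K (tgt C f)) (lat K (src C f)) (res K f)"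
      using suplat_map_comp[OF suplat_map_comp[OF map\<phi>[OF o(2)] L.res_map[OF f]] map\<psi>[OF o(1)]]
      by (rule suplat_map_cong) (rule resK[OF f])
    show "left_adjoint (lat K (src C f)) (lat K (tgt C f)) (sig K f) (res K f)"
      by (rule sig[OF f f])
  next
    fix a u assume a: "a \<in> obj C" and u: "u \<in> carrier (lat K a)"
    then show "res K (idn C a) u = u"
      using resK[of "idn C a" u] L.res_idn[OF a i(1)[OF a u]] i(3)[OF a u]
      by (simp add: L.idn_arr L.src_idn L.tgt_idn)
  next
    fix f g u
    assume fg: "f \<in> arr C" "g \<in> arr C" "tgt C g = src C f" and u: "u \<in> carrier (lat K (tgt C f))"
    note o = L.src_obj[OF fg(2)] L.tgt_obj[OF fg(1)]
    have fu: "res K f u \<in> carrier (lat K (tgt C g))" using closed[OF fg(1) u] fg(3) by simp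
    show "res K (cmp C f g) u = res K g (res K f u)"
    proof (rule inj[OF o(1)])
      show "res K (cmp C f g) u \<in> carrier (lat K (src C g))"
        using closed[OF L.cmp_arr[OF fg]] u fg by (simp add: L.src_cmp L.tgt_cmp)
      show "res K g (res K f u) \<in> carrier (lat K (src C g))" by (rule closed[OF fg(2) fu])
      show "\<phi> (src C g) (res K (cmp C f g) u) = \<phi> (src C g) (res K g (res K f u))"
        using nat[OF L.cmp_arr[OF fg], of u] nat[OF fg(2) fu] nat[OF fg(1) u] u fg
          L.res_cmp[OF fg i(1)[OF o(2) u]]
        by (simp add: L.src_cmp L.tgt_cmp)
    qed
  next
    fix r s p q u assume wp: "weak_pullback C r s p q" and u: "u \<in> carrier (lat K (src C r))"
    have arrs: "r \<in> arr C" "s \<in> arr C" "p \<in> arr C" "q \<in> arr C"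
      and t: "tgt C r = tgt C s" "src C p = src C q" "tgt C p = src C r" "tgt C q = src C s"
      using wp by (auto simp: weak_pullback_def)
    have 1: "sig K r u \<in> carrier (lat K (tgt C s))" using sigK_closed[OF arrs(1) u] t by simp
    have 2: "res K p u \<in> carrier (lat K (src C q))" using closed[OF arrs(3)] u t by simp
    show "res K s (sig K r u) = sig K q (res K p u)"
    proof (rule inj[OF L.src_obj[OF arrs(2)]])
      show "res K s (sig K r u) \<in> carrier (lat K (src C s))" by (rule closed[OF arrs(2) 1])
      show "sig K q (res K p u) \<in> carrier (lat K (src C s))" using sigK_closed[OF arrs(4) 2] t by simp
      show "\<phi> (src C s) (res K s (sig K r u)) = \<phi> (src C s) (sig K q (res K p u))"
        using nat[OF arrs(2) 1] nat_sig[OF arrs(1) u] nat_sig[OF arrs(4) 2] nat[OF arrs(3), of u] u t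
          L.beck_chevalley[OF wp i(1)[OF L.src_obj[OF arrs(1)] u]]
        by simp
    qed
  qed
  moreover have "isuplat_morphism C K L \<phi>"
    unfolding isuplat_morphism_def using map\<phi> nat nat_sig by blast
  moreover have "isuplat_morphism C L K \<psi>"
    unfolding isuplat_morphism_def
  proof (intro conjI ballI map\<psi>)
    fix f v assume f: "f \<in> arr C"
    note o = L.src_obj[OF f] L.tgt_obj[OF f]
    show "\<psi> (src C f) (res L f v) = res K f (\<psi> (tgt C f) v)" if v: "v \<in> carrier (lat L (tgt C f))"
      using resK[OF f i(2)[OF o(2) v]] i(4)[OF o(2) v] by simp
    show "\<psi> (tgt C f) (sig L f v) = sig K f (\<psi> (src C f) v)" if v: "v \<in> carrier (lat L (src C f))"
      using sigK[OF f i(2)[OF o(1) v]] i(4)[OF o(1) v] by simp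
  qed
  moreover have "\<forall>a \<in> obj C. (\<forall>u \<in> carrier (lat K a). \<psi> a (\<phi> a u) = u) \<and>
      (\<forall>v \<in> carrier (lat L a). \<phi> a (\<psi> a v) = v)"
    using i by blast
  ultimately show ?thesis unfolding isuplat_isomorphic_def by blast
qed


section \<open>Power-objects as families of subsets\<close>

text \<open>The subobject of \<open>X \<times> y(a)\<close> that corresponds to \<open>p\<close>, cut into its fibres over the
  arrows into \<open>a\<close>.\<close>

definition slices ::
  "('o, 'm) cat \<Rightarrow> ('o, 'm, 'q) psh \<Rightarrow> ('o \<Rightarrow> ('x \<times> 'q) set) \<Rightarrow> 'o \<Rightarrow> 'q \<Rightarrow> 'm \<Rightarrow> 'x set" where
  "slices C Q E a p = (\<lambda>f \<in> into C a. {x. (x, act Q f p) \<in> E (src C f)})"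

lemma zed_pow_comp_carrier:
  "U \<in> carrier (lat (zed C (pow_comp X)) a) \<longleftrightarrow>
    U \<in> (\<Pi>\<^sub>E f \<in> into C a. Pow (elts X (src C f))) \<and>
    (\<forall>f \<in> into C a. \<forall>g \<in> into C (src C f). act X g ` U f \<subseteq> U (cmp C f g))"
  by (simp add: zed_def zed_lat_def pow_comp_def powerset_lat_def)

lemma zed_pow_comp_le:
  "U \<sqsubseteq>\<^bsub>lat (zed C (pow_comp X)) a\<^esub> V \<longleftrightarrow> (\<forall>f \<in> into C a. U f \<subseteq> V f)"
  by (simp add: zed_def zed_lat_def pow_comp_def powerset_lat_def)

locale presheaf_power_object =
  small_category C + X: presheaf C X
  for C :: "('o, 'm) cat" and X :: "('o, 'm, 'x) psh" +
  fixes Q :: "('o, 'm, 'q) psh" and E :: "'o \<Rightarrow> ('x \<times> 'q) set"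
  assumes PO: "power_object TYPE('m) C X Q E"
begin

lemma Q_presheaf: "presheaf C Q" and E_sub: "subpresheaf C (prod_psh X Q) E"
  using PO by (auto simp: power_object_def)

sublocale Q: presheaf C Q by (rule Q_presheaf)

lemma classifying_map_exists:
  fixes Y :: "('o, 'm, 'm) psh"
  assumes "presheaf C Y" "subpresheaf C (prod_psh X Y) R"
  obtains \<chi> where "nat_trans C Y Q \<chi>" "\<And>b. b \<in> obj C \<Longrightarrow> R b = pull_rel X Y \<chi> E b"
proof -
  have "\<exists>\<chi>. nat_trans C Y Q \<chi> \<and> (\<forall>b \<in> obj C. R b = pull_rel X Y \<chi> E b)"
    using PO assms by (simp add: power_object_def)
  then show thesis using that by blast
qed

lemma classifying_map_unique:
  fixes Y :: "('o, 'm, 'm) psh"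
  assumes Y: "presheaf C Y" and \<chi>: "nat_trans C Y Q \<chi>" and \<chi>': "nat_trans C Y Q \<chi>'"
    and eq: "\<And>b. b \<in> obj C \<Longrightarrow> pull_rel X Y \<chi> E b = pull_rel X Y \<chi>' E b"
    and a: "a \<in> obj C" and y: "y \<in> elts Y a"
  shows "\<chi> a y = \<chi>' a y"
proof -
  have "subpresheaf C (prod_psh X Y) (pull_rel X Y \<chi> E)"
    by (rule pull_rel_subpresheaf[OF X.presheaf_axioms Y \<chi> E_sub])
  with PO Y have "\<forall>\<chi>1 \<chi>2.
      nat_trans C Y Q \<chi>1 \<and> (\<forall>b \<in> obj C. pull_rel X Y \<chi> E b = pull_rel X Y \<chi>1 E b) \<and>
      nat_trans C Y Q \<chi>2 \<and> (\<forall>b \<in> obj C. pull_rel X Y \<chi> E b = pull_rel X Y \<chi>2 E b) \<longrightarrow>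
      (\<forall>a \<in> obj C. \<forall>y \<in> elts Y a. \<chi>1 a y = \<chi>2 a y)"
    unfolding power_object_def by blast
  from this[rule_format, of \<chi> \<chi>' a y] show ?thesis
    using \<chi> \<chi>' eq a y by simp
qed

lemma E_closed: "\<lbrakk>a \<in> obj C; (x, p) \<in> E a\<rbrakk> \<Longrightarrow> x \<in> elts X a \<and> p \<in> elts Q a"
  using E_sub by (auto simp: subpresheaf_def prod_psh_def)

lemma E_act: "\<lbrakk>f \<in> arr C; (x, p) \<in> E (tgt C f)\<rbrakk> \<Longrightarrow> (act X f x, act Q f p) \<in> E (src C f)"
  using E_sub unfolding subpresheaf_def prod_psh_def by force

lemma idn_yoneda: "a \<in> obj C \<Longrightarrow> idn C a \<in> elts (yoneda C a) a"
  by (simp add: yoneda_def idn_arr src_idn tgt_idn)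

lemma mem_subobj_of_iff:
  assumes "b \<in> obj C"
  shows "(x, f) \<in> subobj_of C X Q E a p b \<longleftrightarrow> f \<in> into C a \<and> src C f = b \<and> x \<in> slices C Q E a p f"
  using E_closed[OF assms] by (auto simp: subobj_of_def pull_rel_def yoneda_def into_def slices_def)

lemma subobj_of_subset_iff:
  "(\<forall>b \<in> obj C. subobj_of C X Q E a p b \<subseteq> subobj_of C X Q E a q b) \<longleftrightarrow>
    (\<forall>f \<in> into C a. slices C Q E a p f \<subseteq> slices C Q E a q f)"
  (is "?L \<longleftrightarrow> ?R")
proof
  assume ?L
  show ?R
  proof (intro ballI subsetI)
    fix f x assume f: "f \<in> into C a" and x: "x \<in> slices C Q E a p f"
    then have b: "src C f \<in> obj C" by (simp add: into_def src_obj)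
    have "(x, f) \<in> subobj_of C X Q E a p (src C f)" using f x mem_subobj_of_iff[OF b] by simp
    then have "(x, f) \<in> subobj_of C X Q E a q (src C f)" using \<open>?L\<close> b by blast
    then show "x \<in> slices C Q E a q f" using mem_subobj_of_iff[OF b] by simp
  qed
next
  assume ?R
  show ?L
  proof (intro ballI subsetI)
    fix b z assume b: "b \<in> obj C" and z: "z \<in> subobj_of C X Q E a p b"
    obtain x f where "z = (x, f)" by (cases z)
    then show "z \<in> subobj_of C X Q E a q b"
      using z \<open>?R\<close> by (auto simp: mem_subobj_of_iff[OF b] dest: bspec)
  qed
qed

lemma slices_closed:
  assumes a: "a \<in> obj C" and p: "p \<in> elts Q a"
  shows "slices C Q E a p \<in> carrier (lat (zed C (pow_comp X)) a)"
proof -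
  have "act X g x \<in> slices C Q E a p (cmp C f g)"
    if f: "f \<in> into C a" and g: "g \<in> into C (src C f)" and x: "x \<in> slices C Q E a p f" for f g x
  proof -
    have "(act X g x, act Q g (act Q f p)) \<in> E (src C g)"
      using E_act[of g x "act Q f p"] f g x by (simp add: into_def slices_def)
    moreover have "act Q (cmp C f g) p = act Q g (act Q f p)"
      using Q.act_cmp[of f g p] f g p by (simp add: into_def)
    ultimately show ?thesis
      using f g by (simp add: slices_def into_def cmp_arr tgt_cmp src_cmp)
  qed
  moreover have "x \<in> elts X (src C f)" if "f \<in> into C a" "x \<in> slices C Q E a p f" for f x
    using that E_closed[of "src C f" x] by (simp add: slices_def into_def src_obj)
  ultimately show ?thesis
    unfolding zed_pow_comp_carrier
    by (intro conjI PiE_I ballI image_subsetI PowI subsetI) (simp_all add: slices_def)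
qed

text \<open>Equal slices give the same subobject of \<open>X \<times> y(a)\<close>, so the maps \<open>y(a) \<rightarrow> Q\<close> that
  correspond to \<open>p\<close> and \<open>q\<close> agree by uniqueness of classifying maps, in particular at the
  identity.\<close>

lemma slices_inj:
  assumes a: "a \<in> obj C" and p: "p \<in> elts Q a" and q: "q \<in> elts Q a"
    and eq: "slices C Q E a p = slices C Q E a q"
  shows "p = q"
proof -
  have "pull_rel X (yoneda C a) (\<lambda>b f. act Q f p) E b = pull_rel X (yoneda C a) (\<lambda>b f. act Q f q) E b"
    if "b \<in> obj C" for b
    using mem_subobj_of_iff[OF that] eq unfolding subobj_of_def by auto
  from classifying_map_unique[OF yoneda_presheaf[OF small_category_axioms a]
      yoneda_nat_trans[OF small_category_axioms Q_presheaf a p]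
      yoneda_nat_trans[OF small_category_axioms Q_presheaf a q] this a idn_yoneda[OF a]]
  have "act Q (idn C a) p = act Q (idn C a) q" .
  then show ?thesis using Q.act_idn a p q by simp
qed

text \<open>The family \<open>U\<close> is reassembled into a subobject \<open>R\<close> of \<open>X \<times> y(a)\<close>. Its classifying
  map \<open>\<chi>\<close>, evaluated at the identity as in the Yoneda lemma, is the required element.\<close>

lemma slices_surj:
  assumes a: "a \<in> obj C" and U: "U \<in> carrier (lat (zed C (pow_comp X)) a)"
  shows "\<exists>p \<in> elts Q a. slices C Q E a p = U"
proof -
  have UX: "U f \<subseteq> elts X (src C f)" if "f \<in> into C a" for f
    using U that unfolding zed_pow_comp_carrier by auto
  have Uact: "act X g x \<in> U (cmp C f g)" if "f \<in> into C a" "g \<in> into C (src C f)" "x \<in> U f" for f g x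
    using U that unfolding zed_pow_comp_carrier by blast
  define R where "R b = {(x, f). f \<in> elts (yoneda C a) b \<and> x \<in> U f}" for b
  have R: "subpresheaf C (prod_psh X (yoneda C a)) R"
    unfolding subpresheaf_def
  proof (intro conjI ballI)
    fix b show "R b \<subseteq> elts (prod_psh X (yoneda C a)) b"
      using UX by (auto simp: R_def prod_psh_def yoneda_def into_def)
  next
    fix g assume g: "g \<in> arr C"
    show "act (prod_psh X (yoneda C a)) g ` R (tgt C g) \<subseteq> R (src C g)"
      using g Uact by (auto simp: R_def prod_psh_def yoneda_def into_def cmp_arr src_cmp tgt_cmp)
  qed
  obtain \<chi> where n: "nat_trans C (yoneda C a) Q \<chi>"
    and c: "\<And>b. b \<in> obj C \<Longrightarrow> R b = pull_rel X (yoneda C a) \<chi> E b"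
    using classifying_map_exists[OF yoneda_presheaf[OF small_category_axioms a] R] by blast
  let ?p = "\<chi> a (idn C a)"
  have p: "?p \<in> elts Q a" using n a idn_yoneda[OF a] unfolding nat_trans_def by auto
  have \<chi>: "\<chi> (src C f) f = act Q f ?p" if f: "f \<in> into C a" for f
  proof -
    have "\<chi> (src C f) (act (yoneda C a) f (idn C a)) = act Q f ?p"
      using n f idn_yoneda[OF a] unfolding nat_trans_def into_def by blast
    then show ?thesis using f idn_left by (auto simp: yoneda_def into_def)
  qed
  have "slices C Q E a ?p = U"
  proof
    fix f show "slices C Q E a ?p f = U f"
    proof (cases "f \<in> into C a")
      case True
      then have f: "f \<in> elts (yoneda C a) (src C f)" and b: "src C f \<in> obj C"
        by (auto simp: yoneda_def into_def src_obj)
      have "x \<in> U f \<longleftrightarrow> (x, act Q f ?p) \<in> E (src C f)" for x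
      proof -
        have "x \<in> U f \<longleftrightarrow> (x, f) \<in> R (src C f)" using f by (simp add: R_def)
        also have "\<dots> \<longleftrightarrow> x \<in> elts X (src C f) \<and> (x, act Q f ?p) \<in> E (src C f)"
          unfolding c[OF b] using f \<chi>[OF True] by (simp add: pull_rel_def)
        also have "\<dots> \<longleftrightarrow> (x, act Q f ?p) \<in> E (src C f)" using E_closed[OF b] by blast
        finally show ?thesis .
      qed
      then show ?thesis using True by (auto simp: slices_def)
    next
      case False
      then show ?thesis using U unfolding zed_pow_comp_carrier by (simp add: slices_def PiE_iff extensional_def)
    qed
  qed
  then show ?thesis using p by blast
qed

lemma slices_order_iso:
  assumes a: "a \<in> obj C"
  shows "order_iso (power_lat C X Q E a) (lat (zed C (pow_comp X)) a)
    (slices C Q E a) (inv_into (elts Q a) (slices C Q E a))"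
proof -
  have "bij_betw (slices C Q E a) (elts Q a) (carrier (lat (zed C (pow_comp X)) a))"
    using slices_closed[OF a] slices_inj[OF a] slices_surj[OF a]
    unfolding bij_betw_def inj_on_def by blast
  then show ?thesis
    unfolding order_iso_def zed_pow_comp_le power_lat_def
    by (auto simp: bij_betw_def inv_into_into f_inv_into_f subobj_of_subset_iff)
qed

lemma slices_act:
  assumes f: "f \<in> arr C" and p: "p \<in> elts Q (tgt C f)"
  shows "slices C Q E (src C f) (act Q f p) = res (zed C (pow_comp X)) f (slices C Q E (tgt C f) p)"
proof
  fix h
  show "slices C Q E (src C f) (act Q f p) h = res (zed C (pow_comp X)) f (slices C Q E (tgt C f) p) h"
    using f p Q.act_cmp[OF f, of h p]
    by (auto simp: slices_def zed_def into_def cmp_arr src_cmp tgt_cmp)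
qed

end

theorem corollary2p5:
  fixes C :: "('o, 'm) cat"
    and X :: "('o, 'm, 'x) psh"
    and Q :: "('o, 'm, 'q) psh"
    and E :: "'o \<Rightarrow> ('x \<times> 'q) set"
  assumes "small_category C"
    and "has_weak_pullbacks C"
    and "presheaf C X"
    and "power_object TYPE('m) C X Q E"
  shows "internal_suplattice C (power_isuplat C X Q E) \<and>
         internal_suplattice C (zed C (pow_comp X)) \<and>
         isuplat_isomorphic C (power_isuplat C X Q E) (zed C (pow_comp X))"
proof -
  interpret presheaf_power_object C X Q E
    using assms by (intro presheaf_power_object.intro presheaf_power_object_axioms.intro)
  interpret small_suplat_functor C "pow_comp X"
    using pow_comp_suplat_functor assms by (intro small_suplat_functor.intro)
  note Z = zed_internal_suplattice
  have "internal_suplattice C (power_isuplat C X Q E) \<and>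
      isuplat_isomorphic C (power_isuplat C X Q E) (zed C (pow_comp X))"
  proof (rule internal_suplattice_transport[OF Z])
    fix a assume "a \<in> obj C"
    then show "order_iso (lat (power_isuplat C X Q E) a) (lat (zed C (pow_comp X)) a)
        (slices C Q E a) (inv_into (elts Q a) (slices C Q E a))"
      by (simp add: power_isuplat_def slices_order_iso)
  next
    fix f l
    assume "left_adjoint (lat (power_isuplat C X Q E) (src C f)) (lat (power_isuplat C X Q E) (tgt C f))
      l (res (power_isuplat C X Q E) f)"
    then show "left_adjoint (lat (power_isuplat C X Q E) (src C f)) (lat (power_isuplat C X Q E) (tgt C f))
        (sig (power_isuplat C X Q E) f) (res (power_isuplat C X Q E) f)"
      unfolding power_isuplat_def isuplat.simps slfun.simps
      by (rule someI[where P = "\<lambda>l. left_adjoint (power_lat C X Q E (src C f))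
        (power_lat C X Q E (tgt C f)) l (act Q f)"])
  qed (use Q.act_closed slices_act in \<open>auto simp: power_isuplat_def power_lat_def\<close>)
  then show ?thesis using Z by blast
qed

end
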